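(* Let $A(r)$ denote the combinatorial area of the combinatorial disk $D(r)$ of radius $r$ in the complex $X_7$ (centered at any vertex $v$ of $X_7$), and let $F_n$ denote the $n$-th Fibonacci number. Then for every integer $r\ge 1$, $$A(r) = 7\left(4F_{2r-2} + 3F_{2r-3} - 2\right).$$
   Context: $X_7$ is the simply connected triangulated surface (without boundary) obtained by gluing together equilateral triangles with side length $1$ along their edges so that there are exactly $7$ triangles at every vertex. Combinatorially, it is the tiling of the hyperbolic plane by equilateral triangles with all angles $2\pi/7$, seven around each vertex. Fix any vertex $v$ of $X_7$. The combinatorial disk $D(r)$ of radius $r$ is the subcomplex defined iteratively by: $D(0)=\{v\}$, and $D(r+1)$ is the union of $D(r)$ and all (closed) triangles of $X_7$ that share a vertex with $D(r)$. The combinatorial area $A(r)$ is the number of triangles of $X_7$ contained in $D(r)$. Fibonacci numbers: $F_0=0$, $F_1=1$, $F_{n+1}=F_n+F_{n-1}$, with the recurrence also used to define $F_{-1}=1$ (needed only when $r=1$). *)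

theory Defs
  imports "HOL-Analysis.Analysis" "HOL-Number_Theory.Fib"
begin

section \<open>Abstract simplicial complexes\<close>

text \<open>
  A complex is given by the set \<open>K\<close> of its simplices, each simplex being its (finite, nonempty)
  set of vertices; the vertex set is \<open>\<Union>K\<close>.  (\<open>Polytope.simplicial_complex\<close> only covers finite
  complexes embedded in a Euclidean space.)
\<close>

definition abstract_complex :: "'v set set \<Rightarrow> bool" where
  "abstract_complex K \<longleftrightarrow>
     (\<forall>s\<in>K. finite s \<and> s \<noteq> {}) \<and> (\<forall>s\<in>K. \<forall>t. t \<subseteq> s \<and> t \<noteq> {} \<longrightarrow> t \<in> K)"

definition edges :: "'v set set \<Rightarrow> 'v set set" where
  "edges K = {s \<in> K. card s = 2}"

definition triangles :: "'v set set \<Rightarrow> 'v set set" where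
  "triangles K = {s \<in> K. card s = 3}"

definition link :: "'v set set \<Rightarrow> 'v \<Rightarrow> 'v set set" where
  "link K v = {s \<in> K. v \<notin> s \<and> insert v s \<in> K}"

definition edge_connected :: "'v set set \<Rightarrow> bool" where
  "edge_connected L \<longleftrightarrow> (\<forall>a\<in>\<Union>L. \<forall>b\<in>\<Union>L. (a, b) \<in> {(x, y). {x, y} \<in> edges L}\<^sup>*)"

text \<open>
  Points of the realization are given by barycentric coordinates; the topology is the one
  induced from the product topology on \<open>'v \<Rightarrow> real\<close>.  For locally finite complexes, such as the
  surfaces below, it coincides with the weak topology and with the topology of the length metric
  in which all edges have length 1.
\<close>

definition geometric_realization :: "'v set set \<Rightarrow> ('v \<Rightarrow> real) set" where
  "geometric_realization K =
     {x. (\<forall>v. 0 \<le> x v) \<and> {v. x v \<noteq> 0} \<in> K \<and> (\<Sum>v | x v \<noteq> 0. x v) = 1}"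


section \<open>The complex \<open>X\<^sub>7\<close>\<close>

text \<open>
  The conditions on edges and vertices say that the link of every vertex is a finite connected
  graph in which every vertex has degree 2, i.e. a cycle: the realization is a surface without
  boundary.
\<close>

definition triangulated_surface :: "'v set set \<Rightarrow> bool" where
  "triangulated_surface K \<longleftrightarrow>
     abstract_complex K \<and>
     (\<forall>s\<in>K. card s \<le> 3) \<and>
     (\<forall>s\<in>K. \<exists>t\<in>triangles K. s \<subseteq> t) \<and>
     (\<forall>e\<in>edges K. card {t \<in> triangles K. e \<subseteq> t} = 2) \<and>
     (\<forall>v\<in>\<Union>K. finite (link K v) \<and> edge_connected (link K v))"

text \<open>
  These properties determine the complex up to isomorphism.  The library's \<open>simply_connected\<close>
  includes path-connectedness.
\<close>

definition is_X7 :: "'v set set \<Rightarrow> bool" where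
  "is_X7 K \<longleftrightarrow>
     triangulated_surface K \<and>
     (\<forall>v\<in>\<Union>K. card {t \<in> triangles K. v \<in> t} = 7) \<and>
     simply_connected (geometric_realization K)"


section \<open>Combinatorial disks and their area\<close>

text \<open>A closed triangle is the set of all simplices \<open>s \<subseteq> t\<close> of a triangle \<open>t\<close>.\<close>

fun combinatorial_disk :: "'v set set \<Rightarrow> 'v \<Rightarrow> nat \<Rightarrow> 'v set set" where
  "combinatorial_disk K v 0 = {{v}}"
| "combinatorial_disk K v (Suc r) =
     combinatorial_disk K v r \<union>
     {s \<in> K. \<exists>t\<in>triangles K. s \<subseteq> t \<and> t \<inter> \<Union>(combinatorial_disk K v r) \<noteq> {}}"

definition combinatorial_area :: "'v set set \<Rightarrow> 'v \<Rightarrow> nat \<Rightarrow> nat" where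
  "combinatorial_area K v r = card (triangles (combinatorial_disk K v r))"


section \<open>Fibonacci numbers with integer index\<close>

definition fib_int :: "int \<Rightarrow> int" where
  "fib_int n = (if n \<ge> 0 then int (fib (nat n))
                else (- 1) ^ (nat (- n) + 1) * int (fib (nat (- n))))"

lemma fib_int_0: "fib_int 0 = 0"
  and fib_int_1: "fib_int 1 = 1"
  and fib_int_minus_1: "fib_int (- 1) = 1"
  by (simp_all add: fib_int_def)

lemma fib_int_rec: "fib_int (n + 1) = fib_int n + fib_int (n - 1)"
proof -
  consider (pos) "n \<ge> 1" | (zero) "n = 0" | (neg) "n \<le> - 1" by linarith
  then show ?thesis
  proof cases
    case pos
    then obtain k where "n = int (Suc k)"
      by (metis One_nat_def Suc_le_D nat_0_le nat_mono nat_one_as_int order_trans zero_le_one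
          int_nat_eq)
    then have "nat (n + 1) = Suc (Suc k)" "nat n = Suc k" "nat (n - 1) = k" by auto
    with pos show ?thesis by (simp add: fib_int_def)
  next
    case zero
    then show ?thesis by (simp add: fib_int_def)
  next
    case neg
    define k where "k = nat (- n - 1)"
    have n: "n = - int (Suc k)" using neg by (simp add: k_def)
    have eqs: "nat (- n) = Suc k" "nat (- (n - 1)) = Suc (Suc k)" "nat (- (n + 1)) = k"
      by (auto simp: n)
    show ?thesis
    proof (cases "k = 0")
      case True
      then show ?thesis by (simp add: fib_int_def n eqs numeral_2_eq_2)
    next
      case False
      then have "\<not> n \<ge> 0" "\<not> n + 1 \<ge> 0" "\<not> n - 1 \<ge> 0" by (auto simp: n)
      then show ?thesis unfolding fib_int_def eqs by (simp add: algebra_simps)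
    qed
  qed
qed

end

theory Submission
  imports Defs
begin

text \<open>
  The spheres of the expected picture of \<open>X\<^sub>7\<close> are cycles whose vertices have either one or two
  neighbours on the previous sphere, and correspondingly four or three on the next one, with
  consecutive vertices sharing one.  This describes a model with explicit vertex names.  Turning
  from edge to edge around each vertex of \<open>K\<close> develops the model into \<open>K\<close>, starting at \<open>v\<close>; the
  developing map is bijective on vertex stars, hence a simplicial covering, and it is injective
  because the realization of \<open>K\<close> is simply connected.  So disks can be counted in the model: its
  sphere of radius \<open>n \<ge> 1\<close> has \<open>7 F\<^sub>2\<^sub>n\<close> vertices, and as many edges; each edge bounds one triangle inside
  and one outside, so that \<open>A(r) = \<Sum>\<^bsub>n\<le>r\<^esub> 7 F\<^sub>2\<^sub>n + \<Sum>\<^bsub>n<r\<^esub> 7 F\<^sub>2\<^sub>n = 7 (F\<^bsub>2r+1\<^esub> + F\<^bsub>2r-1\<^esub> - 2)\<close>.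
\<close>

section \<open>Simplicial coverings of a simply connected complex\<close>

lemma abstract_complex_face:
  "abstract_complex K \<Longrightarrow> s \<in> K \<Longrightarrow> t \<subseteq> s \<Longrightarrow> t \<noteq> {} \<Longrightarrow> t \<in> K"
  unfolding abstract_complex_def by blast

text \<open>
  A piecewise linear parametrization, through the points of the realization, of the edge path
  \<open>u 0, \<dots>, u k\<close>: at time \<open>j / k\<close> it is at the vertex \<open>u j\<close>.
\<close>

definition walk_path :: "(nat \<Rightarrow> 'v) \<Rightarrow> nat \<Rightarrow> real \<Rightarrow> 'v \<Rightarrow> real" where
  "walk_path u k t w = (\<Sum>j\<le>k. max 0 (1 - \<bar>real k * t - real j\<bar>) * of_bool (u j = w))"

text \<open>During the \<open>i\<close>-th segment all tent functions vanish except those centred at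
  \<open>i\<close> and \<open>Suc i\<close>. If \<open>u i = u (Suc i)\<close>, the two terms merge
  into the constant 1, so a walk may pause.\<close>

lemma walk_path_segment:
  assumes "i < k" "real i \<le> real k * t" "real k * t \<le> real i + 1"
  shows "walk_path u k t w =
    (real i + 1 - real k * t) * of_bool (u i = w) + (real k * t - real i) * of_bool (u (Suc i) = w)"
proof -
  have zero: "max 0 (1 - \<bar>real k * t - real j\<bar>) = 0" if "j \<notin> {i, Suc i}" for j
  proof -
    have "j < i \<or> j > Suc i" using that by auto
    then have "real j + 1 \<le> real i \<or> real j \<ge> real i + 2" by linarith
    then show ?thesis using assms by auto
  qed
  have "walk_path u k t w =
      (\<Sum>j\<in>{i, Suc i}. max 0 (1 - \<bar>real k * t - real j\<bar>) * of_bool (u j = w))"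
    unfolding walk_path_def
    by (rule sum.mono_neutral_right) (use assms zero in auto)
  then show ?thesis using assms by auto
qed

lemma walk_path_segment_support:
  assumes "i < k" "real i \<le> real k * t" "real k * t \<le> real i + 1" "walk_path u k t w > 0"
  shows "w \<in> {u i, u (Suc i)}"
  using walk_path_segment[OF assms(1-3), of u w] assms(4)
  by (auto simp: of_bool_def split: if_splits)

lemma walk_path_continuous: "continuous_on S (walk_path u k)"
  unfolding walk_path_def
  by (intro continuous_on_coordinatewise_then_product continuous_intros)

lemma walk_path_loop:
  assumes "u k = u 0" "k \<ge> 1"
  shows "walk_path u k 1 = walk_path u k 0"
proof
  fix w
  have "walk_path u k 1 w = of_bool (u k = w)"
    using walk_path_segment[of "k - 1" k 1 u w] assms by (simp add: of_nat_diff)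
  moreover have "walk_path u k 0 w = of_bool (u 0 = w)"
    using walk_path_segment[of 0 k 0 u w] assms by simp
  ultimately show "walk_path u k 1 w = walk_path u k 0 w" using assms by simp
qed

lemma walk_path_in_realization:
  assumes K: "abstract_complex K" and walk: "\<And>j. j < k \<Longrightarrow> {u j, u (Suc j)} \<in> K"
    and "k \<ge> 1" and t: "t \<in> {0..1}"
  shows "walk_path u k t \<in> geometric_realization K"
proof -
  obtain i where i: "i < k" "real i \<le> real k * t" "real k * t \<le> real i + 1"
  proof (cases "t = 1")
    case True
    \<comment> \<open>At \<open>t = 1\<close> the floor of \<open>k * t\<close> is \<open>k\<close>,
      which is no segment, so the last one is taken.\<close>
    show ?thesis by (rule that[of "k - 1"]) (use True assms in \<open>auto simp: of_nat_diff\<close>)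
  next
    case False
    have "real k * t < real k" using False t assms by simp
    moreover have "real k * t \<ge> 0" using t by simp
    ultimately show ?thesis by (intro that[of "nat \<lfloor>real k * t\<rfloor>"]) linarith+
  qed
  note seg = walk_path_segment[OF i]
  let ?x = "walk_path u k t"
  have nonneg: "?x w \<ge> 0" for w using seg[of u w] i by simp
  have supp: "{w. ?x w \<noteq> 0} \<subseteq> {u i, u (Suc i)}" using seg[of u] by auto
  have "sum ?x {w. ?x w \<noteq> 0} = sum ?x {u i, u (Suc i)}"
    by (rule sum.mono_neutral_left) (use supp in auto)
  also have "\<dots> = 1" by (cases "u i = u (Suc i)") (auto simp: seg)
  finally have total: "sum ?x {w. ?x w \<noteq> 0} = 1" .
  then have "{w. ?x w \<noteq> 0} \<noteq> {}" by (metis sum.empty zero_neq_one)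
  then have "{w. ?x w \<noteq> 0} \<in> K"
    using abstract_complex_face[OF K walk[OF i(1)] supp] by blast
  with nonneg total show ?thesis unfolding geometric_realization_def by simp
qed

text \<open>Vertices whose open stars share the point \<open>x\<close> all lie in the simplex that
  supports \<open>x\<close>.\<close>

lemma realization_support_face:
  assumes "abstract_complex K" "x \<in> geometric_realization K" "s \<noteq> {}" "\<And>w. w \<in> s \<Longrightarrow> x w > 0"
  shows "s \<in> K"
proof -
  have "{w. x w \<noteq> 0} \<in> K" using assms(2) by (simp add: geometric_realization_def)
  moreover have "s \<subseteq> {w. x w \<noteq> 0}" using assms(4) by force
  ultimately show ?thesis using abstract_complex_face assms(1,3) by metis
qed

lemma realization_positive_coordinate:
  assumes "abstract_complex K" "x \<in> geometric_realization K"
  obtains w where "x w > 0"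
proof -
  have "{w. x w \<noteq> 0} \<in> K" "\<And>w. x w \<ge> 0"
    using assms(2) by (auto simp: geometric_realization_def)
  moreover from this have "{w. x w \<noteq> 0} \<noteq> {}" using assms(1) abstract_complex_def by blast
  ultimately show ?thesis using that by (metis (mono_tags, lifting) Collect_empty_eq less_eq_real_def)
qed

text \<open>
  The relation \<open>N\<close> is the reflexive adjacency of the covering complex, whose vertex set is \<open>S\<close>.
  Only its vertices and edges are recorded; its triangles are determined by \<open>N_triangle\<close>.
\<close>

locale simplicial_covering =
  fixes K :: "'v set set" and S :: "'x set" and p :: "'x \<Rightarrow> 'v" and N :: "'x \<Rightarrow> 'x \<Rightarrow> bool"
  assumes complex: "abstract_complex K"
    and N_refl: "a \<in> S \<Longrightarrow> N a a"
    and N_sym: "N a b \<Longrightarrow> N b a"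
    and N_in: "N a b \<Longrightarrow> a \<in> S"
    and N_edge: "N a b \<Longrightarrow> {p a, p b} \<in> K"
    and N_inj: "N a b \<Longrightarrow> N a c \<Longrightarrow> p b = p c \<Longrightarrow> b = c"
    and N_lift: "a \<in> S \<Longrightarrow> {p a, w} \<in> K \<Longrightarrow> \<exists>b. N a b \<and> p b = w"
    and N_triangle: "N a b \<Longrightarrow> N a c \<Longrightarrow> {p a, p b, p c} \<in> K \<Longrightarrow> N b c"
begin

section \<open>Walks, their lifts and monodromy\<close>

definition lifts :: "(nat \<Rightarrow> 'x) \<Rightarrow> (nat \<Rightarrow> 'v) \<Rightarrow> nat \<Rightarrow> bool" where
  "lifts b u n \<longleftrightarrow> (\<forall>j<n. N (b j) (b (Suc j))) \<and> (\<forall>j\<le>n. p (b j) = u j)"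

text \<open>All lifts are considered, whatever their starting point, so that neighbouring loops with
  different base points can be compared.\<close>

definition trivial_monodromy :: "(nat \<Rightarrow> 'v) \<Rightarrow> nat \<Rightarrow> bool" where
  "trivial_monodromy u n \<longleftrightarrow> (\<forall>b. lifts b u n \<longrightarrow> b n = b 0)"

lemma lifts_exist:
  assumes "a \<in> S" "p a = u 0" "\<And>j. j < n \<Longrightarrow> {u j, u (Suc j)} \<in> K"
  shows "\<exists>b. b 0 = a \<and> lifts b u n"
  using assms(3)
proof (induction n)
  case 0
  show ?case by (rule exI[of _ "\<lambda>_. a"]) (simp add: lifts_def assms)
next
  case (Suc n)
  then obtain b where b: "b 0 = a" "lifts b u n" by auto
  have "b n \<in> S"
  proof (cases n)
    case 0
    then show ?thesis using b assms by simp
  next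
    case (Suc m)
    then show ?thesis using b(2) N_in N_sym unfolding lifts_def by (metis lessI)
  qed
  moreover have "p (b n) = u n" using b(2) by (simp add: lifts_def)
  ultimately obtain c where c: "N (b n) c" "p c = u (Suc n)"
    using N_lift[of "b n" "u (Suc n)"] Suc.prems[of n] by auto
  show ?case
    by (rule exI[of _ "b(Suc n := c)"])
      (use b c in \<open>auto simp: lifts_def less_Suc_eq le_Suc_eq\<close>)
qed

text \<open>
  Lifts of two walks along a strip of simplices stay adjacent, so they close up together.
\<close>

lemma trivial_monodromy_shift:
  assumes triv: "trivial_monodromy w n"
    and sq: "\<And>j. j < n \<Longrightarrow> {u j, u (Suc j), w j, w (Suc j)} \<in> K"
    and "n \<ge> 1" "w n = w 0" "u n = u 0"
  shows "trivial_monodromy u n"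
  unfolding trivial_monodromy_def
proof (intro allI impI)
  fix a assume a: "lifts a u n"
  have face: "s \<in> K" if "j < n" "s \<subseteq> {u j, u (Suc j), w j, w (Suc j)}" "s \<noteq> {}" for s j
    using abstract_complex_face[OF complex sq[OF that(1)] that(2,3)] .
  have "a 0 \<in> S" using a assms(3) N_in unfolding lifts_def by (metis One_nat_def Suc_le_lessD)
  moreover have "p (a 0) = u 0" using a by (simp add: lifts_def)
  ultimately obtain b0 where b0: "N (a 0) b0" "p b0 = w 0"
    using N_lift[of "a 0" "w 0"] face[of 0 "{u 0, w 0}"] assms(3) by auto
  obtain b where b: "b 0 = b0" "lifts b w n"
    using lifts_exist[of b0 w n] b0 N_in N_sym face by (metis insert_iff insert_not_empty subset_iff empty_iff)
  have "N (a j) (b j)" if "j \<le> n" for j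
    using that
  proof (induction j)
    case 0
    show ?case using b0 b by simp
  next
    case (Suc j)
    then have IH: "N (a j) (b j)" and j: "j < n" by auto
    have steps: "N (a j) (a (Suc j))" "N (b j) (b (Suc j))" using a b(2) j by (auto simp: lifts_def)
    have vals: "p (a j) = u j" "p (a (Suc j)) = u (Suc j)" "p (b j) = w j" "p (b (Suc j)) = w (Suc j)"
      using a b(2) j by (auto simp: lifts_def)
    \<comment> \<open>Each cell of the strip is cut by a diagonal: the triangle condition at
      \<open>a j\<close> gives the diagonal, and at \<open>b j\<close> it gives the next
      rung.\<close>
    have "N (b j) (a (Suc j))"
      using N_triangle[OF IH steps(1)] face[OF j] vals by auto
    with steps(2) show ?case
      using N_triangle[of "b j" "a (Suc j)" "b (Suc j)"] face[OF j] vals by auto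
  qed
  from this[of n] this[of 0] have "N (a n) (b n)" "N (a 0) (b 0)" by auto
  moreover have "b n = b 0" using triv b(2) by (simp add: trivial_monodromy_def)
  moreover have "p (a n) = p (a 0)" using a assms(5) by (simp add: lifts_def)
  ultimately show "a n = a 0" using N_inj N_sym by metis
qed

text \<open>The lift never leaves the star of \<open>b 0\<close>, on which \<open>p\<close> is
  injective.\<close>

lemma trivial_monodromy_in_simplex:
  assumes s: "s \<in> K" and w: "\<And>j. j \<le> n \<Longrightarrow> w j \<in> s" and "n \<ge> 1" "w n = w 0"
  shows "trivial_monodromy w n"
  unfolding trivial_monodromy_def
proof (intro allI impI)
  fix b assume b: "lifts b w n"
  have b0: "b 0 \<in> S" using b assms(3) N_in unfolding lifts_def by (metis One_nat_def Suc_le_lessD)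
  have "N (b 0) (b j)" if "j \<le> n" for j
    using that
  proof (induction j)
    case 0
    show ?case using N_refl b0 .
  next
    case (Suc j)
    have "p (b 0) = w 0" "p (b j) = w j" "p (b (Suc j)) = w (Suc j)" "N (b j) (b (Suc j))"
      using b Suc.prems by (auto simp: lifts_def)
    moreover have "{w j, w 0, w (Suc j)} \<in> K"
      by (rule abstract_complex_face[OF complex s]) (use w Suc.prems in auto)
    ultimately show ?case using Suc N_triangle[of "b j" "b 0" "b (Suc j)"] N_sym by auto
  qed
  from this[of n] have "N (b 0) (b n)" by simp
  moreover have "p (b n) = p (b 0)" using b assms(4) by (simp add: lifts_def)
  ultimately show "b n = b 0" using N_inj N_refl b0 by metis
qed

text \<open>A lift of \<open>u\<close>, slowed down by pausing at each vertex, lifts the slowed walk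
  because \<open>N\<close> is reflexive. This fits a loop of \<open>k\<close> edges to a grid with
  \<open>k * m\<close> columns.\<close>

lemma trivial_monodromy_refine:
  assumes triv: "trivial_monodromy (\<lambda>j. u (j div m)) (k * m)" and "m \<ge> 1" "k \<ge> 1"
  shows "trivial_monodromy u k"
  unfolding trivial_monodromy_def
proof (intro allI impI)
  fix b assume b: "lifts b u k"
  have step: "N (b (j div m)) (b (Suc j div m))" if "j < k * m" for j
  proof -
    have lt: "j div m < k" using that by (simp add: less_mult_imp_div_less)
    then have N: "N (b (j div m)) (b (Suc (j div m)))" using b by (simp add: lifts_def)
    then have "N (b (j div m)) (b (j div m))" using N_refl N_in by blast
    with N show ?thesis by (simp add: div_Suc)
  qed
  have "lifts (\<lambda>j. b (j div m)) (\<lambda>j. u (j div m)) (k * m)"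
    using b step div_le_mono[of _ "k * m" m] assms(2) by (auto simp: lifts_def)
  then have "b (k * m div m) = b (0 div m)" using triv unfolding trivial_monodromy_def by blast
  then show "b k = b 0" using assms(2) by simp
qed


text \<open>
  A null homotopy of the loop is cut into cells so small that each lies in the open star of some
  vertex \<open>W i j\<close>.  Stars of neighbouring cells meet, so consecutive rows of the grid bound strips of
  simplices, and triviality of the monodromy passes from the constant end of the homotopy down to
  the given loop.
\<close>

lemma trivial_monodromy_of_loop:
  assumes sc: "simply_connected (geometric_realization K)"
    and walk: "\<And>j. j < k \<Longrightarrow> {u j, u (Suc j)} \<in> K"
    and "k \<ge> 1" and closed: "u k = u 0"
  shows "trivial_monodromy u k"
proof -
  let ?R = "geometric_realization K"
  let ?Q = "{0..1::real} \<times> {0..1::real}"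
  let ?g = "walk_path u k"
  have g_in: "?g t \<in> ?R" if "t \<in> {0..1}" for t
    using walk_path_in_realization[of K k u t] complex walk assms(3) that by blast
  have g_loop: "?g 1 = ?g 0" using walk_path_loop closed assms(3) by blast
  have "path ?g" "pathfinish ?g = pathstart ?g" "path_image ?g \<subseteq> ?R"
    using walk_path_continuous g_loop g_in
    by (auto simp: path_def pathfinish_def pathstart_def path_image_def)
  moreover have "path (\<lambda>_. ?g 0)" "pathfinish (\<lambda>_. ?g 0) = pathstart (\<lambda>_. ?g 0)"
      "path_image (\<lambda>_. ?g 0) \<subseteq> ?R"
    using g_in by (auto simp: path_def pathfinish_def pathstart_def path_image_def)
  \<comment> \<open>A free homotopy: the base point may move, so at intermediate times only
    \<open>h (s, 1) = h (s, 0)\<close> is available.\<close>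
  ultimately have "homotopic_loops ?R ?g (\<lambda>_. ?g 0)"
    using sc unfolding simply_connected_def by blast
  then obtain h where h: "continuous_on ?Q h" "h \<in> ?Q \<rightarrow> ?R"
      "\<forall>x\<in>{0..1}. h (0, x) = ?g x" "\<forall>x\<in>{0..1}. h (1, x) = ?g 0"
      "\<forall>t\<in>{0..1}. pathfinish (h \<circ> Pair t) = pathstart (h \<circ> Pair t)"
    unfolding homotopic_loops by blast
  have h_in: "h x \<in> ?R" if "x \<in> ?Q" for x using h(2) that by blast
  have h_loop: "h (s, 1) = h (s, 0)" if "s \<in> {0..1}" for s
    using h(5) that by (auto simp: pathfinish_def pathstart_def)

  \<comment> \<open>Open sets whose part in the square is mapped into a single open star;
    \<open>\<epsilon>\<close> below is a Lebesgue number of this cover.\<close>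
  define \<G> where "\<G> = {A. open A \<and> (\<exists>w. \<forall>x\<in>A \<inter> ?Q. h x w > 0)}"
  have "?Q \<subseteq> \<Union>\<G>"
  proof
    fix x assume x: "x \<in> ?Q"
    obtain w where w: "h x w > 0"
      using realization_positive_coordinate[OF complex h_in[OF x]] by blast
    have "continuous_on ?Q (\<lambda>x. h x w)"
      using h(1) by (rule continuous_on_product_then_coordinatewise)
    then obtain A where A: "open A" "A \<inter> ?Q = (\<lambda>x. h x w) -` {0<..} \<inter> ?Q"
      unfolding continuous_on_open_invariant by (metis open_greaterThan)
    then have "A \<in> \<G>" unfolding \<G>_def by blast
    moreover have "x \<in> A" using A(2) w x by auto
    ultimately show "x \<in> \<Union>\<G>" by blast
  qed
  moreover have "compact ?Q" by (intro compact_Times) auto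
  ultimately obtain \<epsilon> where \<epsilon>: "\<epsilon> > 0" "\<And>x. x \<in> ?Q \<Longrightarrow> \<exists>G\<in>\<G>. ball x \<epsilon> \<subseteq> G"
    using Heine_Borel_lemma[of ?Q \<G>] unfolding \<G>_def by blast

  obtain m :: nat where m: "real m > 2 / \<epsilon>" using reals_Archimedean2 by blast
  then have m1: "m \<ge> 1" using \<epsilon>(1) by (cases m) (auto simp: field_simps)
  \<comment> \<open>Cells of side \<open>1 / M\<close> have taxicab diameter
    \<open>2 / M < \<epsilon>\<close>; a multiple of \<open>k\<close> keeps every column within one
    edge of the loop.\<close>
  define M where "M = k * m"
  have M1: "M \<ge> 1" using m1 assms(3) by (simp add: M_def)
  have "M \<ge> m" using assms(3) by (simp add: M_def)
  then have "real M \<ge> real m" by simp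
  then have "real M > 2 / \<epsilon>" using m by linarith
  then have M: "2 / real M < \<epsilon>" using \<epsilon>(1) M1 by (simp add: field_simps)
  define cell where "cell i = {real i / M .. (real i + 1) / M}" for i
  have frac: "real i / M \<in> {0..1}" if "i \<le> M" for i
    using that M1 by auto
  have "\<exists>w. \<forall>x\<in>cell i \<times> cell j. h x w > 0" if ij: "i < M" "j < M" for i j
  proof -
    let ?c = "(real i / M, real j / M)"
    have "?c \<in> ?Q" using frac[of i] frac[of j] ij by simp
    from \<epsilon>(2)[OF this] obtain G where G: "G \<in> \<G>" "ball ?c \<epsilon> \<subseteq> G" by auto
    have "x \<in> ball ?c \<epsilon> \<inter> ?Q" if x: "x \<in> cell i \<times> cell j" for x
    proof -
      obtain s t where st: "x = (s, t)" "s \<in> cell i" "t \<in> cell j" using x by auto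
      have up: "(real i + 1) / M \<le> 1" "(real j + 1) / M \<le> 1" using ij by auto
      have d: "\<bar>real i / M - s\<bar> \<le> 1 / M" "\<bar>real j / M - t\<bar> \<le> 1 / M"
        using st unfolding cell_def by (auto simp: add_divide_distrib abs_if)
      have "dist ?c x \<le> \<bar>real i / M - s\<bar> + \<bar>real j / M - t\<bar>"
        unfolding st dist_Pair_Pair dist_real_def
        using sqrt_sum_squares_le_sum_abs by auto
      also have "\<dots> \<le> 2 / M" using d by simp
      finally have "dist ?c x < \<epsilon>" using M by simp
      moreover have "s \<in> {0..1}" "t \<in> {0..1}"
        using order_trans[of 0 "real i / M" s] order_trans[of 0 "real j / M" t]
          order_trans[OF _ up(1), of s] order_trans[OF _ up(2), of t] st
        unfolding cell_def by simp_all
      ultimately show ?thesis using st by simp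
    qed
    then show ?thesis using G unfolding \<G>_def by blast
  qed
  then obtain W0 where W0: "\<And>i j x. i < M \<Longrightarrow> j < M \<Longrightarrow> x \<in> cell i \<times> cell j \<Longrightarrow> h x (W0 i j) > 0"
    by metis
  \<comment> \<open>Column \<open>M\<close> is identified with column 0, so every row closes
    up.\<close>
  define W where "W i j = W0 i (if j = M then 0 else j)" for i j
  have W_left: "h (s, real j / M) (W i j) > 0" if "i < M" "j \<le> M" "s \<in> cell i" for i j s
  proof (cases "j = M")
    case True
    have "0 \<in> cell 0" by (simp add: cell_def)
    moreover have "s \<in> {0..1}"
    proof -
      have "(real i + 1) / M \<le> 1" using that by auto
      moreover have "0 \<le> real i / M" by simp
      ultimately show ?thesis using that(3) unfolding cell_def by (meson atLeastAtMost_iff order_trans)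
    qed
    ultimately show ?thesis
      using W0[of i 0 "(s, 0)"] that M1 h_loop[of s] True by (simp add: W_def)
  next
    case False
    then show ?thesis using W0[of i j "(s, real j / M)"] that
      by (simp add: W_def cell_def divide_right_mono)
  qed
  have W_right: "h (s, real (Suc j) / M) (W i j) > 0" if "i < M" "j < M" "s \<in> cell i" for i j s
    using W0[of i j "(s, real (Suc j) / M)"] that
    by (simp add: W_def cell_def divide_right_mono add.commute)
  have W_closed: "W i M = W i 0" for i by (simp add: W_def)

  have rows: "trivial_monodromy (W i) M" if "i < M" for i
    using that
  \<comment> \<open>The induction starts at the constant end \<open>s = 1\<close>: there all stars
    of the row contain the point \<open>?g 0\<close>, so the row lies in one simplex.\<close>
  proof (induction "M - 1 - i" arbitrary: i)
    case 0
    then have i: "i = M - 1" by simp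
    have one: "1 \<in> cell i" using i M1 by (simp add: cell_def of_nat_diff)
    have z: "h (1, x) = ?g 0" if "x \<in> {0..1}" for x using h(4) that by blast
    have "W i j \<in> {w. ?g 0 w \<noteq> 0}" if "j \<le> M" for j
      using W_left[OF 0(2) that one] z[OF frac[OF that]] by auto
    moreover have "{w. ?g 0 w \<noteq> 0} \<in> K"
      using g_in[of 0] by (simp add: geometric_realization_def)
    ultimately show ?case
      using trivial_monodromy_in_simplex[of "{w. ?g 0 w \<noteq> 0}" M "W i"] M1 W_closed by blast
  next
    case (Suc l)
    then have i: "Suc i < M" by simp
    have s: "real (Suc i) / M \<in> cell i" "real (Suc i) / M \<in> cell (Suc i)"
      by (simp_all add: cell_def divide_right_mono add.commute)
    have "trivial_monodromy (W (Suc i)) M" using Suc i by simp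
    \<comment> \<open>All four open stars contain the image of the grid point
      \<open>(Suc i / M, Suc j / M)\<close>.\<close>
    moreover have "{W i j, W i (Suc j), W (Suc i) j, W (Suc i) (Suc j)} \<in> K" if "j < M" for j
    proof (rule realization_support_face[OF complex])
      show "h (real (Suc i) / M, real (Suc j) / M) \<in> ?R"
        using h_in frac[of "Suc i"] frac[of "Suc j"] i that by auto
    qed (use W_left[of _ "Suc j"] W_right[of _ j] s i that in auto)
    ultimately show ?case
      using trivial_monodromy_shift W_closed M1 by blast
  qed

  have z0: "0 \<in> cell 0" by (simp add: cell_def)
  have W_left0: "?g (real j / M) (W 0 j) > 0" if "j \<le> M" for j
    using W_left[OF _ that z0] M1 h(3) frac[OF that] by auto
  have W_right0: "?g (real (Suc j) / M) (W 0 j) > 0" if "j < M" for j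
    using W_right[OF _ that z0] M1 h(3) frac[of "Suc j"] that by auto
  have scale: "real k * (real j / M) = real j / m" for j
    using assms(3) by (simp add: M_def)
  \<comment> \<open>On the side \<open>s = 0\<close> the homotopy is the loop itself, and column
    \<open>j\<close> runs inside its edge number \<open>j div m\<close>, so the stars met there
    belong to the end points of that edge.\<close>
  have "{u (j div m), u (Suc j div m), W 0 j, W 0 (Suc j)} \<in> K" if j: "j < M" for j
  proof -
    define i where "i = j div m"
    have i: "i < k" using j by (simp add: i_def M_def less_mult_imp_div_less)
    have "i * m \<le> j" "j < Suc i * m"
      using dividend_less_div_times[of m j] m1 by (simp_all add: i_def)
    then have bounds: "real i * real m \<le> real j" "real j + 1 \<le> (real i + 1) * real m"
    proof -
      show "real i * real m \<le> real j" using \<open>i * m \<le> j\<close> by (metis of_nat_le_iff of_nat_mult)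
      have "Suc j \<le> Suc i * m" using \<open>j < Suc i * m\<close> by simp
      then have "real (Suc j) \<le> real (Suc i * m)" by (simp only: of_nat_le_iff)
      then show "real j + 1 \<le> (real i + 1) * real m" by (simp add: algebra_simps)
    qed
    have seg: "real i \<le> real k * (real j / M)" "real k * (real j / M) \<le> real i + 1"
      "real i \<le> real k * (real (Suc j) / M)" "real k * (real (Suc j) / M) \<le> real i + 1"
      unfolding scale using bounds m1 by (simp_all add: field_simps)
    have W1: "W 0 j \<in> {u i, u (Suc i)}"
      using walk_path_segment_support[OF i seg(1,2) W_left0] j by simp
    have W2: "W 0 (Suc j) \<in> {u i, u (Suc i)}"
      using walk_path_segment_support[OF i seg(3,4) W_left0[of "Suc j"]] j by simp
    have "u (Suc j div m) \<in> {u i, u (Suc i)}" by (simp add: div_Suc i_def)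
    with W1 W2 have "{u (j div m), u (Suc j div m), W 0 j, W 0 (Suc j)} \<subseteq> {u i, u (Suc i)}"
      unfolding i_def by auto
    then show ?thesis using abstract_complex_face[OF complex walk[OF i]] by blast
  qed
  moreover have "u (M div m) = u (0 div m)" using closed m1 by (simp add: M_def)
  ultimately have "trivial_monodromy (\<lambda>j. u (j div m)) M"
    using trivial_monodromy_shift[OF rows[of 0]] M1 W_closed by simp
  then show ?thesis using trivial_monodromy_refine m1 assms(3) unfolding M_def by blast
qed

text \<open>A chain from \<open>a\<close> to \<open>b\<close> projects to a closed walk, of which
  the chain itself is a lift; trivial monodromy closes it.\<close>

theorem simply_connected_covering_injective:
  assumes "simply_connected (geometric_realization K)"
    and "(a, b) \<in> {(x, y). N x y}\<^sup>*" "p a = p b"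
  shows "a = b"
proof -
  obtain n f where f: "f 0 = a" "f n = b" "\<forall>i<n. N (f i) (f (Suc i))"
    using assms(2) unfolding rtrancl_power relpow_fun_conv by blast
  show ?thesis
  proof (cases "n = 0")
    case False
    have "trivial_monodromy (p \<circ> f) n"
      using trivial_monodromy_of_loop[OF assms(1), of n "p \<circ> f"] f assms(3) N_edge False by simp
    moreover have "lifts f (p \<circ> f) n" using f(3) by (simp add: lifts_def)
    ultimately show ?thesis using f unfolding trivial_monodromy_def by metis
  qed (use f in simp)
qed

end


section \<open>Stars of vertices in a triangulated surface\<close>

text \<open>With at most two neighbours per vertex, a walk that never turns back can first repeat
  itself only at its starting point, and the cycle it closes uses up both neighbours of each of its
  vertices.\<close>

lemma nonbacktracking_walk_cycle:
  fixes s :: "nat \<Rightarrow> 'a" and A :: "'a \<Rightarrow> 'a \<Rightarrow> bool"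
  assumes sym: "\<And>x y. A x y \<Longrightarrow> A y x" and irrefl: "\<And>x. \<not> A x x"
    and deg: "\<And>x a b c. A x a \<Longrightarrow> A x b \<Longrightarrow> A x c \<Longrightarrow> a \<noteq> b \<Longrightarrow> c = a \<or> c = b"
    and walk: "\<And>n. A (s n) (s (Suc n))" and turn: "\<And>n. s (Suc (Suc n)) \<noteq> s n"
    and fin: "finite (range s)"
  obtains m where "m \<ge> 3" "inj_on s {..<m}" "s m = s 0" "s (Suc m) = s 1"
    "\<And>x y. x \<in> s ` {..<m} \<Longrightarrow> A x y \<Longrightarrow> y \<in> s ` {..<m}"
proof -
  have "\<exists>j. \<exists>i<j. s i = s j"
  proof (rule ccontr)
    assume "\<not> ?thesis"
    then have "inj s" by (metis injI linorder_neqE_nat)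
    then show False using fin finite_imageD infinite_UNIV_nat by blast
  qed
  then obtain m where "\<exists>i<m. s i = s m" and least: "\<And>j. j < m \<Longrightarrow> \<not> (\<exists>i<j. s i = s j)"
    using exists_least_iff[of "\<lambda>j. \<exists>i<j. s i = s j"] by blast
  then obtain i where i: "i < m" "s i = s m" by blast
  have inj: "inj_on s {..<m}"
    by (rule linorder_inj_onI) (use least in auto)
  \<comment> \<open>Otherwise \<open>s i\<close> has the neighbours \<open>s (i - 1)\<close>,
    \<open>s (i + 1)\<close> and \<open>s (m - 1)\<close>. The last must equal one of the others,
    which yields an earlier repetition, a loop or a turn back.\<close>
  have i0: "i = 0"
  proof (rule ccontr)
    assume "i \<noteq> 0"
    then obtain k where k: "i = Suc k" by (cases i) auto
    obtain l where l: "m = Suc l" using i by (cases m) auto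
    have "A (s i) (s k)" "A (s i) (s (Suc i))" "A (s i) (s l)"
      using sym[OF walk[of k]] walk[of i] sym[OF walk[of l]] i k l by auto
    then have "s l = s k \<or> s l = s (Suc i)" using deg turn[of k] k by metis
    then consider "s l = s k" | "s l = s (Suc i)" by blast
    then show False
    proof cases
      case 1
      then show False using least[of l] k l i by auto
    next
      case 2
      show False
      proof (cases "Suc i < l")
        case True
        then show False using least[of l] 2 l by auto
      next
        case False
        then have "l = i \<or> l = Suc i" using i l by auto
        then show False
        proof
          assume "l = i"
          then show False using irrefl walk[of i] i l by metis
        next
          assume "l = Suc i"
          then show False using turn[of i] i l by metis
        qed
      qed
    qed
  qed
  have closed: "s m = s 0" using i i0 by simp
  have "m \<noteq> 1" using closed irrefl walk[of 0] by auto
  moreover have "m \<noteq> 2" using closed turn[of 0] by (auto simp: numeral_2_eq_2)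
  ultimately have m3: "m \<ge> 3" using i i0 by linarith
  define l where "l = m - 1"
  have l: "m = Suc l" "l \<ge> 2" using m3 by (auto simp: l_def)
  have prev: "A (s 0) (s l)" using sym[OF walk[of l]] closed l by auto
  have "s l \<noteq> s 1" using inj_onD[OF inj, of l 1] l by auto
  \<comment> \<open>Arriving from \<open>s l\<close>, the walk has to leave \<open>s 0\<close>
    towards its other neighbour.\<close>
  have second: "s (Suc m) = s 1"
  proof -
    have "A (s 0) (s (Suc m))" using walk[of m] closed by simp
    moreover have "s (Suc m) \<noteq> s l" using turn[of l] l by simp
    ultimately show ?thesis using deg[OF prev _ _ \<open>s l \<noteq> s 1\<close>] walk[of 0] by (metis One_nat_def)
  qed
  have "y \<in> s ` {..<m}" if x: "x \<in> s ` {..<m}" and xy: "A x y" for x y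
  proof -
    obtain j where j: "j < m" "x = s j" using x by auto
    show ?thesis
    proof (cases j)
      case 0
      then have "y = s l \<or> y = s 1"
        using deg[OF prev _ _ \<open>s l \<noteq> s 1\<close>] walk[of 0] j xy by (metis One_nat_def)
      then show ?thesis using l by auto
    next
      case (Suc k)
      then have "A x (s k)" "A x (s (Suc j))" "s k \<noteq> s (Suc j)"
        using sym[OF walk[of k]] walk[of j] j turn[of k] by auto
      then have y: "y = s k \<or> y = s (Suc j)" using deg xy by blast
      have "s (Suc j) \<in> s ` {..<m}"
      proof (cases "Suc j = m")
        case True
        then show ?thesis using closed m3 by auto
      qed (use j in auto)
      then show ?thesis using y j Suc by auto
    qed
  qed
  then show ?thesis using that m3 inj closed second by blast
qed

text \<open>
  The apex, other than \<open>x\<close>, of a triangle on the edge \<open>e\<close>; meaningful only if \<open>insert x e\<close> is a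
  triangle of a surface, since then there is exactly one such apex.
\<close>

definition opp :: "'v set set \<Rightarrow> 'v \<Rightarrow> 'v set \<Rightarrow> 'v" where
  "opp K x e = (THE z. z \<noteq> x \<and> insert z e \<in> triangles K)"

text \<open>The link of \<open>w\<close> as a 7-cycle, with arbitrary starting point and
  direction.\<close>

definition wheel :: "'v set set \<Rightarrow> 'v \<Rightarrow> 'v list \<Rightarrow> bool" where
  "wheel K w ys \<longleftrightarrow> length ys = 7 \<and> distinct ys \<and>
     {t \<in> triangles K. w \<in> t} = (\<lambda>i. {w, ys ! i, ys ! (Suc i mod 7)}) ` {..<7}"

lemma triangle_distinct:
  assumes "{x, y, z} \<in> triangles K"
  shows "x \<noteq> y" "y \<noteq> z" "x \<noteq> z"
  using assms by (auto simp: triangles_def card_insert_if split: if_splits)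

lemma triangle_as_insert:
  assumes "t \<in> triangles K" "w \<in> t" "x \<in> t" "w \<noteq> x"
  obtains z where "t = {w, x, z}"
proof -
  have "card t = 3" using assms by (simp add: triangles_def)
  then have "card (t - {w, x}) = 1" using assms by (subst card_Diff_subset) auto
  then obtain z where "t - {w, x} = {z}" by (auto simp: card_1_singleton_iff)
  then have "t = {w, x, z}" using assms by auto
  then show ?thesis using that by blast
qed

lemma surface_complex: "triangulated_surface K \<Longrightarrow> abstract_complex K"
  by (simp add: triangulated_surface_def)

context
  fixes K :: "'v set set"
  assumes surface: "triangulated_surface K"
begin

lemma edge_in_triangle:
  assumes "{w, x} \<in> K" "w \<noteq> x"
  obtains z where "{w, x, z} \<in> triangles K"
proof -
  have "\<forall>s\<in>K. \<exists>t\<in>triangles K. s \<subseteq> t"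
    using surface by (simp add: triangulated_surface_def)
  then obtain t where t: "t \<in> triangles K" "{w, x} \<subseteq> t" using assms(1) by blast
  then obtain z where "t = {w, x, z}"
    using triangle_as_insert[of t K w x] assms(2) by blast
  with t(1) that show ?thesis by blast
qed

text \<open>The two triangles on an edge have different apexes; this makes reflection in an edge,
  that is \<open>opp\<close>, well defined.\<close>

lemma triangles_at_edge:
  assumes "{w, y, x} \<in> triangles K"
  obtains z where "z \<noteq> x" "\<And>a. {w, y, a} \<in> triangles K \<longleftrightarrow> a = x \<or> a = z"
proof -
  note d = triangle_distinct[OF assms]
  have "{w, y, x} \<in> K" using assms by (simp add: triangles_def)
  then have "{w, y} \<in> K"
    by (rule abstract_complex_face[OF surface_complex[OF surface]]) auto
  then have "{w, y} \<in> edges K" using d by (simp add: edges_def)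
  moreover have "\<forall>e\<in>edges K. card {t \<in> triangles K. e \<subseteq> t} = 2"
    using surface by (simp add: triangulated_surface_def)
  ultimately have "card {t \<in> triangles K. {w, y} \<subseteq> t} = 2" by blast
  then obtain t t' where tt: "{t \<in> triangles K. {w, y} \<subseteq> t} = {t, t'}" "t \<noteq> t'"
    unfolding card_2_iff by blast
  have "{w, y, x} \<in> {t \<in> triangles K. {w, y} \<subseteq> t}" using assms by simp
  then have "{w, y, x} = t \<or> {w, y, x} = t'" unfolding tt(1) by simp
  then have "\<exists>t2. {t \<in> triangles K. {w, y} \<subseteq> t} = {{w, y, x}, t2} \<and> t2 \<noteq> {w, y, x}"
    unfolding tt(1) using tt(2) by (metis insert_commute)
  then obtain t2 where t2: "{t \<in> triangles K. {w, y} \<subseteq> t} = {{w, y, x}, t2}" "t2 \<noteq> {w, y, x}"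
    by auto
  have "t2 \<in> {t \<in> triangles K. {w, y} \<subseteq> t}" unfolding t2(1) by simp
  then have t2_in: "t2 \<in> triangles K" "w \<in> t2" "y \<in> t2" by simp_all
  obtain z where z: "t2 = {w, y, z}" using triangle_as_insert[OF t2_in d(1)] .
  have "{w, y, a} \<in> triangles K \<longleftrightarrow> a = x \<or> a = z" for a
  proof
    assume a: "{w, y, a} \<in> triangles K"
    then have "{w, y, a} \<in> {t \<in> triangles K. {w, y} \<subseteq> t}" by simp
    then have "{w, y, a} = {w, y, x} \<or> {w, y, a} = {w, y, z}" unfolding t2(1) z by simp
    then have "a \<in> {w, y, x} \<or> a \<in> {w, y, z}" by (metis insertCI)
    with triangle_distinct[OF a] show "a = x \<or> a = z" by simp
  qed (use assms t2_in(1) z in auto)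
  moreover have "z \<noteq> x" using t2(2) unfolding z by metis
  ultimately show ?thesis using that by blast
qed

lemma opp_eqI:
  assumes "{w, y, x} \<in> triangles K" "{w, y, z} \<in> triangles K" "z \<noteq> x"
  shows "opp K x {w, y} = z"
proof -
  obtain z' where z': "z' \<noteq> x" "\<And>a. {w, y, a} \<in> triangles K \<longleftrightarrow> a = x \<or> a = z'"
    using triangles_at_edge[OF assms(1)] by blast
  have ins: "insert a {w, y} = {w, y, a}" for a by auto
  show ?thesis unfolding opp_def ins
    by (rule the_equality) (use assms z' in auto)
qed

lemma opp_triangle:
  assumes "{w, y, x} \<in> triangles K"
  shows "{w, y, opp K x {w, y}} \<in> triangles K" "opp K x {w, y} \<noteq> x"
proof -
  obtain z where z: "z \<noteq> x" "\<And>a. {w, y, a} \<in> triangles K \<longleftrightarrow> a = x \<or> a = z"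
    using triangles_at_edge[OF assms] by blast
  then have "opp K x {w, y} = z" using opp_eqI assms by blast
  with z show "{w, y, opp K x {w, y}} \<in> triangles K" "opp K x {w, y} \<noteq> x" by auto
qed

text \<open>Walks around the link of \<open>w\<close>, starting along the edge from \<open>x\<close>
  to \<open>y\<close>.\<close>

fun rotation :: "'v \<Rightarrow> 'v \<Rightarrow> 'v \<Rightarrow> nat \<Rightarrow> 'v" where
  "rotation w x y 0 = x"
| "rotation w x y (Suc 0) = y"
| "rotation w x y (Suc (Suc n)) = opp K (rotation w x y n) {w, rotation w x y (Suc n)}"

text \<open>The link is a finite connected graph of degree two, so the walk closes up into a cycle
  and reaches all of it. A cycle of \<open>m\<close> link vertices carries \<open>m\<close>
  triangles, hence \<open>m = 7\<close>.\<close>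

lemma rotation_cycle:
  assumes xy: "{w, x, y} \<in> triangles K" and seven: "card {t \<in> triangles K. w \<in> t} = 7"
  shows "inj_on (rotation w x y) {..<7}" "rotation w x y 7 = x"
    "{t \<in> triangles K. w \<in> t} =
       (\<lambda>i. {w, rotation w x y i, rotation w x y (Suc i)}) ` {..<7}"
    "{w, rotation w x y n, rotation w x y (Suc n)} \<in> triangles K"
    "rotation w x y (Suc (Suc n)) \<noteq> rotation w x y n"
proof -
  let ?s = "rotation w x y"
  define A where "A a b \<longleftrightarrow> {w, a, b} \<in> triangles K" for a b
  have sym: "A a b \<Longrightarrow> A b a" for a b unfolding A_def by (metis insert_commute)
  have walk: "A (?s n) (?s (Suc n))" for n
  proof (induction n)
    case (Suc n)
    then have "A (?s (Suc n)) (?s n)" by (rule sym)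
    then show ?case using opp_triangle(1)[of w "?s (Suc n)" "?s n"] unfolding A_def by simp
  qed (use xy in \<open>simp add: A_def\<close>)
  then show "{w, ?s n, ?s (Suc n)} \<in> triangles K" by (simp add: A_def)
  have turn: "?s (Suc (Suc n)) \<noteq> ?s n" for n
    using opp_triangle(2)[of w "?s (Suc n)" "?s n"] sym[OF walk[of n]] unfolding A_def by simp
  then show "?s (Suc (Suc n)) \<noteq> ?s n" .
  have irrefl: "\<not> A a a" for a using triangle_distinct unfolding A_def by metis
  have deg: "c = a \<or> c = b" if "A q a" "A q b" "A q c" "a \<noteq> b" for q a b c
    using triangles_at_edge[of w q a] that unfolding A_def by metis
  have complex: "abstract_complex K" using surface_complex surface .
  have w: "w \<in> \<Union>K" using xy by (auto simp: triangles_def)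
  have link_vertex: "a \<in> \<Union>(link K w)" if "A a b" for a b
  proof -
    have "{w, a, b} \<in> K" "w \<noteq> a"
      using that triangle_distinct(1)[of w a b K] by (auto simp: A_def triangles_def)
    then have "{a} \<in> K" "{w, a} \<in> K" using abstract_complex_face[OF complex] by auto
    then have "{a} \<in> link K w" using \<open>w \<noteq> a\<close> by (simp add: link_def)
    then show ?thesis by blast
  qed
  have "finite (link K w)"
    using w surface unfolding triangulated_surface_def by blast
  moreover have "finite t" if "t \<in> link K w" for t
    using that complex by (simp add: link_def abstract_complex_def)
  ultimately have "finite (\<Union>(link K w))" by blast
  moreover have "range ?s \<subseteq> \<Union>(link K w)" using link_vertex[OF walk] by blast
  ultimately have fin: "finite (range ?s)" by (rule finite_subset[rotated])
  obtain m where m: "m \<ge> 3" "inj_on ?s {..<m}" "?s m = ?s 0" "?s (Suc m) = ?s 1"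
    "\<And>a b. a \<in> ?s ` {..<m} \<Longrightarrow> A a b \<Longrightarrow> b \<in> ?s ` {..<m}"
  proof (rule nonbacktracking_walk_cycle[of A ?s, OF _ irrefl _ walk turn fin])
    show "\<And>a b. A a b \<Longrightarrow> A b a" by (fact sym)
    show "\<And>q a b c. A q a \<Longrightarrow> A q b \<Longrightarrow> A q c \<Longrightarrow> a \<noteq> b \<Longrightarrow> c = a \<or> c = b" by (fact deg)
  qed (rule that)
  have conn: "edge_connected (link K w)"
    using w surface unfolding triangulated_surface_def by blast
  have all: "b \<in> ?s ` {..<m}" if b: "b \<in> \<Union>(link K w)" for b
  proof -
    have "(x, b) \<in> {(a, b). {a, b} \<in> edges (link K w)}\<^sup>*"
      using conn b link_vertex[of x y] xy unfolding edge_connected_def A_def by blast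
    then show ?thesis
    proof (induction rule: rtrancl_induct)
      case base
      show ?case using m(1) by (intro image_eqI[of _ _ 0]) auto
    next
      case (step b c)
      then have "{b, c} \<in> K" "w \<notin> {b, c}" "{w, b, c} \<in> K" "card {b, c} = 2"
        by (auto simp: edges_def link_def)
      then have "A b c" unfolding A_def triangles_def by (auto simp: card_insert_if)
      then show ?case using step m(5) by blast
    qed
  qed
  let ?f = "\<lambda>i. {w, ?s i, ?s (Suc i)}"
  have triangles: "{t \<in> triangles K. w \<in> t} = ?f ` {..<m}"
  proof (intro subset_antisym subsetI)
    fix t assume "t \<in> {t \<in> triangles K. w \<in> t}"
    then have t: "t \<in> triangles K" "w \<in> t" by auto
    then have "card (t - {w}) = 2" by (simp add: triangles_def)
    then obtain a b where ab: "t - {w} = {a, b}" by (auto simp: card_2_iff)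
    then have t_eq: "t = {w, a, b}" using t by auto
    then have Aab: "A a b" using t A_def by simp
    then obtain i where i: "i < m" "a = ?s i" using all[OF link_vertex] by auto
    \<comment> \<open>The edge from \<open>a\<close> to \<open>b\<close> is one of the two cycle
      edges at \<open>a\<close>; for \<open>i = 0\<close> the preceding one wraps around to index
      \<open>m - 1\<close>.\<close>
    show "t \<in> ?f ` {..<m}"
    proof (cases i)
      case 0
      define l where "l = m - 1"
      have l: "m = Suc l" "l \<ge> 2" using m(1) by (auto simp: l_def)
      have "?s l \<noteq> ?s 1" using inj_onD[OF m(2), of l 1] l by auto
      moreover have "A a (?s l)" "A a (?s 1)" using sym[OF walk[of l]] walk[of 0] m(3) l i 0 by auto
      ultimately have "b = ?s l \<or> b = ?s 1" using deg Aab by blast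
      then show ?thesis
      proof
        assume "b = ?s l"
        then have "t = ?f l" using t_eq i 0 m(3) l by auto
        then show ?thesis using l by blast
      next
        assume "b = ?s 1"
        then have "t = ?f 0" using t_eq i 0 by auto
        then show ?thesis using l by blast
      qed
    next
      case (Suc k)
      then have "A a (?s k)" "A a (?s (Suc i))" "?s k \<noteq> ?s (Suc i)"
        using sym[OF walk[of k]] walk[of i] i turn[of k] by auto
      then have "b = ?s k \<or> b = ?s (Suc i)" using deg Aab by blast
      then have "t = ?f k \<or> t = ?f i"
        unfolding t_eq i(2) Suc by (metis insert_commute)
      moreover have "k < m" using i(1) Suc by simp
      ultimately show ?thesis using i(1) by blast
    qed
  next
    fix t assume "t \<in> ?f ` {..<m}"
    then obtain i where "t = ?f i" by blast
    then show "t \<in> {t \<in> triangles K. w \<in> t}" using walk[of i] by (simp add: A_def)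
  qed
  \<comment> \<open>A repeated triangle would mean a link edge traversed in both directions, which
    happens only in a cycle of length two.\<close>
  have "inj_on ?f {..<m}"
  proof (rule linorder_inj_onI)
    fix i j assume ij: "i < j" "i \<in> {..<m}" "j \<in> {..<m}"
    show "?f i \<noteq> ?f j"
    proof
      assume eq: "?f i = ?f j"
      have diff: "?f l - {w} = {?s l, ?s (Suc l)}" for l
        using triangle_distinct(1,3)[of w "?s l" "?s (Suc l)" K] walk[of l] by (auto simp: A_def)
      have "{?s i, ?s (Suc i)} = {?s j, ?s (Suc j)}"
        using arg_cong[OF eq, of "\<lambda>t. t - {w}"] unfolding diff .
      moreover have "?s i \<noteq> ?s j" using inj_onD[OF m(2), of i j] ij by auto
      ultimately have si: "?s i = ?s (Suc j)" and sj: "?s (Suc i) = ?s j"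
        by (auto simp: doubleton_eq_iff)
      have m': "Suc j = m"
        using inj_onD[OF m(2) si] ij by (cases "Suc j < m") auto
      have "?s i = ?s 0" using si m(3) unfolding m' by simp
      then have "i = 0" using inj_onD[OF m(2), of i 0] ij by auto
      then have "j = 1" using inj_onD[OF m(2) sj] ij m(1) by auto
      then show False using m' m(1) by simp
    qed
  qed auto
  then have "m = 7" using seven unfolding triangles by (simp add: card_image)
  then show "inj_on ?s {..<7}" "?s 7 = x" "{t \<in> triangles K. w \<in> t} = ?f ` {..<7}"
    using m triangles by simp_all
qed

text \<open>The form in which \<open>develop\<close> supplies its equations: \<open>y0\<close>,
  \<open>y1\<close>, \<open>y2\<close> are known, \<open>y3\<close> to \<open>y5\<close> come from
  turning forwards, and \<open>y6\<close> from turning backwards at \<open>y0\<close>. Length seven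
  makes both ends meet.\<close>

lemma wheel_of_rotation:
  assumes "{w, y0, y1} \<in> triangles K" "{w, y1, y2} \<in> triangles K" "y0 \<noteq> y2"
    and seven: "card {t \<in> triangles K. w \<in> t} = 7"
    and "y3 = opp K y1 {w, y2}" "y4 = opp K y2 {w, y3}" "y5 = opp K y3 {w, y4}"
      "y6 = opp K y1 {w, y0}"
  shows "wheel K w [y0, y1, y2, y3, y4, y5, y6]"
proof -
  let ?s = "rotation w y0 y1"
  note rot = rotation_cycle[OF assms(1) seven]
  have "?s 2 = y2"
    using opp_eqI[of w y1 y0 y2] assms by (simp add: numeral_2_eq_2 insert_commute)
  then have s2: "?s (Suc (Suc 0)) = y2" by (simp add: numeral_2_eq_2)
  have "opp K (?s 1) {w, ?s 0} = ?s 6"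
  proof (rule opp_eqI)
    show "{w, ?s 0, ?s 1} \<in> triangles K" using assms(1) by simp
    show "{w, ?s 0, ?s 6} \<in> triangles K"
      using rot(4)[of 6] rot(2) by (simp add: insert_commute)
    show "?s 6 \<noteq> ?s 1" using inj_onD[OF rot(1), of 6 1] by auto
  qed
  then have y6: "?s 6 = y6" using assms by simp
  have list: "map ?s [0..<7] = [y0, y1, y2, y3, y4, y5, y6]" (is "_ = ?ys")
  proof -
    have upt: "[0..<7] = [0, 1, 2, 3, 4, 5, 6::nat]" by (simp add: upt_rec)
    have "?s 3 = y3" "?s 4 = y4" "?s 5 = y5"
      using s2 assms(5-7) by (simp_all add: numeral_eq_Suc)
    then show ?thesis using y6 \<open>?s 2 = y2\<close> unfolding upt by simp
  qed
  then have nth: "?ys ! i = ?s i" if "i < 7" for i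
    using that by (metis add_0 diff_zero length_upt nth_map nth_upt)
  have "?s (Suc i) = ?ys ! (Suc i mod 7)" if "i < 7" for i
    using that nth[of "Suc i"] rot(2) by (cases "i = 6") auto
  then have "(\<lambda>i. {w, ?s i, ?s (Suc i)}) ` {..<7} = (\<lambda>i. {w, ?ys ! i, ?ys ! (Suc i mod 7)}) ` {..<7}"
    using nth by (intro image_cong) auto
  moreover have "distinct ?ys"
    unfolding list[symmetric] using rot(1) by (simp add: distinct_map atLeast0LessThan)
  ultimately show ?thesis using rot(3) by (simp add: wheel_def)
qed

lemma wheel_exists:
  assumes w: "w \<in> \<Union>K" and seven: "card {t \<in> triangles K. w \<in> t} = 7"
  shows "\<exists>ys. wheel K w ys"
proof -
  have "{t \<in> triangles K. w \<in> t} \<noteq> {}" using seven by (metis card.empty zero_neq_numeral)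
  then obtain t where t: "t \<in> triangles K" "w \<in> t" by blast
  then have "card (t - {w}) = 2" by (simp add: triangles_def)
  then obtain a b where "t - {w} = {a, b}" by (auto simp: card_2_iff)
  then have "t = {w, a, b}" using t by auto
  with t have ab: "{w, a, b} \<in> triangles K" by simp
  let ?c = "opp K a {w, b}"
  have "{w, b, ?c} \<in> triangles K" "a \<noteq> ?c"
    using opp_triangle[of w b a] ab by (auto simp: insert_commute)
  from wheel_of_rotation[OF ab this seven] show ?thesis by blast
qed

lemma wheel_neighbour:
  assumes "wheel K w ys" "{w, x} \<in> K" "x \<noteq> w"
  shows "x \<in> set ys"
proof -
  obtain z where "{w, x, z} \<in> triangles K" using edge_in_triangle[of w x] assms by auto
  then obtain i where i: "i < 7" "{w, x, z} = {w, ys ! i, ys ! (Suc i mod 7)}"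
    using assms(1) unfolding wheel_def by blast
  then have "x = ys ! i \<or> x = ys ! (Suc i mod 7)" using assms(3) by blast
  moreover have "length ys = 7" using assms(1) by (simp add: wheel_def)
  ultimately show ?thesis using i by auto
qed

end

lemma wheel_triangle:
  assumes "wheel K w ys" "i < 7"
  shows "{w, ys ! i, ys ! (Suc i mod 7)} \<in> triangles K"
  using assms unfolding wheel_def by blast


lemma wheel_spoke:
  assumes "abstract_complex K" "wheel K w ys" "x \<in> set ys"
  shows "x \<noteq> w" "{w, x} \<in> K"
proof -
  have "length ys = 7" using assms(2) by (simp add: wheel_def)
  then obtain i where i: "i < 7" "x = ys ! i" using assms(3) by (metis in_set_conv_nth)
  note t = wheel_triangle[OF assms(2) i(1)]
  then have K: "{w, ys ! i, ys ! (Suc i mod 7)} \<in> K" by (simp add: triangles_def)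
  have "{w, ys ! i} \<in> K" by (rule abstract_complex_face[OF assms(1) K]) auto
  with triangle_distinct(1)[OF t] i show "x \<noteq> w" "{w, x} \<in> K" by auto
qed


section \<open>The model\<close>

text \<open>
  Names for the vertices of \<open>X\<^sub>7\<close>.  A vertex \<open>u \<noteq> Root\<close> lies on a cycle of vertices of the same level,
  between \<open>prv u\<close> and \<open>nxt u\<close>.  Its neighbours one level further out are, in cyclic order, \<open>C0 u\<close>
  (which is also a neighbour of \<open>prv u\<close>), \<open>C1 u\<close>, \<open>C2 u\<close> and \<open>C0 (nxt u)\<close>; here \<open>C2 u\<close> is missing if
  \<open>u\<close> is itself shared by two vertices of the previous level.  The predicate \<open>valid\<close> singles out the
  names that are in use.
\<close>

datatype vert = Root | Base nat | C0 vert | C1 vert | C2 vert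

fun shared :: "vert \<Rightarrow> bool" where
  "shared (C0 u) = True"
| "shared u = False"

fun level :: "vert \<Rightarrow> nat" where
  "level Root = 0"
| "level (Base i) = 1"
| "level (C0 u) = Suc (level u)"
| "level (C1 u) = Suc (level u)"
| "level (C2 u) = Suc (level u)"

fun valid :: "vert \<Rightarrow> bool" where
  "valid Root = True"
| "valid (Base i) = (i < 7)"
| "valid (C0 u) = (valid u \<and> u \<noteq> Root)"
| "valid (C1 u) = (valid u \<and> u \<noteq> Root)"
| "valid (C2 u) = (valid u \<and> u \<noteq> Root \<and> \<not> shared u)"

definition last_child :: "vert \<Rightarrow> vert" where
  "last_child u = (if shared u then C1 u else C2 u)"

fun prv :: "vert \<Rightarrow> vert" where
  "prv Root = Root"
| "prv (Base i) = Base ((i + 6) mod 7)"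
| "prv (C0 u) = last_child (prv u)"
| "prv (C1 u) = C0 u"
| "prv (C2 u) = C1 u"

fun nxt :: "vert \<Rightarrow> vert" where
  "nxt Root = Root"
| "nxt (Base i) = Base (Suc i mod 7)"
| "nxt (C0 u) = C1 u"
| "nxt (C1 u) = (if shared u then C0 (nxt u) else C2 u)"
| "nxt (C2 u) = C0 (nxt u)"

text \<open>For \<open>u \<noteq> Root\<close> this is the common parent of \<open>u\<close> and
  \<open>prv u\<close>; of the two parents of a shared vertex it is the one on the
  \<open>prv\<close> side. The value at \<open>Root\<close> is a default.\<close>

fun lpar :: "vert \<Rightarrow> vert" where
  "lpar Root = Root"
| "lpar (Base i) = Root"
| "lpar (C0 u) = prv u"
| "lpar (C1 u) = u"
| "lpar (C2 u) = u"

text \<open>The seven neighbours in cyclic order, so that consecutive ones span a triangle with the centre.\<close>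

fun nbrs :: "vert \<Rightarrow> vert list" where
  "nbrs Root = [Base 0, Base 1, Base 2, Base 3, Base 4, Base 5, Base 6]"
| "nbrs (C0 t) = [C1 t, t, prv t, prv (C0 t), C0 (C0 t), C1 (C0 t), C0 (C1 t)]"
| "nbrs u = [nxt u, lpar u, prv u, C0 u, C1 u, C2 u, C0 (nxt u)]"

lemma last_child_simps [simp]:
  "level (last_child u) = Suc (level u)" "last_child u \<noteq> Root" "lpar (last_child u) = u"
  "valid (last_child u) \<longleftrightarrow> valid u \<and> u \<noteq> Root" "\<not> shared (last_child u)"
  "nxt (last_child u) = C0 (nxt u)" "last_child u = last_child t \<longleftrightarrow> u = t"
  by (auto simp: last_child_def)

lemma level_prv [simp]: "level (prv u) = level u"
  by (induction u) auto

lemma level_nxt [simp]: "level (nxt u) = level u"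
  by (induction u) auto

lemma level_0_iff [simp]: "level u = 0 \<longleftrightarrow> u = Root"
  by (cases u) auto

lemma prv_Root_iff [simp]: "prv u = Root \<longleftrightarrow> u = Root" "nxt u = Root \<longleftrightarrow> u = Root"
  by (metis level_0_iff level_prv level_nxt)+

lemma level_lpar: "u \<noteq> Root \<Longrightarrow> Suc (level (lpar u)) = level u"
  by (cases u) auto

lemma less_7_cases: "i < (7::nat) \<Longrightarrow> i = 0 \<or> i = 1 \<or> i = 2 \<or> i = 3 \<or> i = 4 \<or> i = 5 \<or> i = 6"
  by auto

lemma valid_prv [simp]: "valid u \<Longrightarrow> valid (prv u)"
  by (induction u) auto

lemma valid_nxt [simp]: "valid u \<Longrightarrow> valid (nxt u)"
  by (induction u) auto

lemma valid_lpar [simp]: "valid u \<Longrightarrow> valid (lpar u)"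
  by (cases u) auto

lemma nxt_prv [simp]: "valid u \<Longrightarrow> nxt (prv u) = u"
  by (induction u) (auto dest!: less_7_cases)

lemma prv_nxt [simp]: "valid u \<Longrightarrow> prv (nxt u) = u"
  by (induction u) (auto simp: last_child_def dest!: less_7_cases)

text \<open>\<open>lpar (nxt u)\<close> is a common parent of \<open>u\<close> and
  \<open>nxt u\<close>, and an unshared \<open>u\<close> has only one parent, whereas
  \<open>C0 t\<close> has the parents \<open>t\<close> and \<open>prv t\<close>.\<close>

lemma lpar_nxt: "valid u \<Longrightarrow> \<not> shared u \<Longrightarrow> lpar (nxt u) = lpar u"
  by (cases u) auto

lemma nbrs_nonshared:
  "u \<noteq> Root \<Longrightarrow> \<not> shared u \<Longrightarrow>
    nbrs u = [nxt u, lpar u, prv u, C0 u, C1 u, C2 u, C0 (nxt u)]"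
  by (cases u) auto

lemma length_nbrs [simp]: "length (nbrs u) = 7"
  by (cases u) auto

text \<open>The two triangles on the edge from \<open>prv u\<close> to \<open>u\<close>: the outer one and the inner one.\<close>

definition up :: "vert \<Rightarrow> vert set" where "up u = {u, prv u, C0 u}"
definition down :: "vert \<Rightarrow> vert set" where "down u = {u, prv u, lpar u}"

section \<open>Triangles and adjacency in the model\<close>

definition corners :: "vert \<Rightarrow> vert set set" where
  "corners u = (\<lambda>i. {u, nbrs u ! i, nbrs u ! (Suc i mod 7)}) ` {..<7}"

lemma corners_list:
  assumes "nbrs u = [a, b, c, d, e, f, g]"
  shows "corners u = {{u, a, b}, {u, b, c}, {u, c, d}, {u, d, e}, {u, e, f}, {u, f, g}, {u, g, a}}"
proof -
  have "{..<7::nat} = {0, 1, 2, 3, 4, 5, 6}" by auto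
  then show ?thesis unfolding corners_def assms by simp
qed

lemma corners_Root: "corners Root = (\<lambda>i. down (Base i)) ` {..<7}"
proof -
  \<comment> \<open>Listed from 1 because the corner on \<open>Base i\<close> and its successor is
    \<open>down\<close> of the successor.\<close>
  have seven: "{..<7::nat} = {1, 2, 3, 4, 5, 6, 0}" by auto
  have "down (Base j) = {Root, Base ((j + 6) mod 7), Base j}" for j
    by (auto simp: down_def)
  then show ?thesis
    unfolding corners_list[OF nbrs.simps(1)] seven by simp
qed

text \<open>Triangles are named after edges of level cycles: four sit on the edges from
  \<open>u\<close> to \<open>prv u\<close> and to \<open>nxt u\<close>, three on the edges between
  consecutive outer neighbours of \<open>u\<close>.\<close>

lemma corners_nonshared:
  assumes "valid u" "u \<noteq> Root" "\<not> shared u"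
  shows "corners u = {down (nxt u), down u, up u, down (C1 u), down (C2 u), down (C0 (nxt u)), up (nxt u)}"
proof -
  have last: "prv (C0 (nxt u)) = C2 u" using assms by (simp add: last_child_def)
  have "{u, nxt u, lpar u} = down (nxt u)" "{u, lpar u, prv u} = down u"
    "{u, prv u, C0 u} = up u" "{u, C0 u, C1 u} = down (C1 u)" "{u, C1 u, C2 u} = down (C2 u)"
    "{u, C2 u, C0 (nxt u)} = down (C0 (nxt u))" "{u, C0 (nxt u), nxt u} = up (nxt u)"
    unfolding down_def up_def lpar_nxt[OF assms(1,3)] last using assms(1) by auto
  then show ?thesis unfolding corners_list[OF nbrs_nonshared[OF assms(2,3)]] by simp
qed

text \<open>Compared with the unshared case there is one outer edge less, and instead the triangle
  \<open>up t\<close> between \<open>u\<close> and its two parents.\<close>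

lemma corners_shared:
  assumes "valid u" "u = C0 t"
  shows "corners u = {down (nxt u), up t, down u, up u, down (C1 u), down (C0 (nxt u)), up (nxt u)}"
proof -
  have last: "prv (C0 (nxt u)) = C1 u" using assms by (simp add: last_child_def)
  have "{u, C1 t, t} = down (nxt u)" "{u, t, prv t} = up t" "{u, prv t, prv u} = down u"
    "{u, prv u, C0 u} = up u" "{u, C0 u, C1 u} = down (C1 u)"
    "{u, C1 u, C0 (C1 t)} = down (C0 (nxt u))" "{u, C0 (C1 t), C1 t} = up (nxt u)"
    unfolding down_def up_def last using assms by auto
  then show ?thesis
    unfolding corners_list[OF nbrs.simps(2)[of t, folded assms(2)]] by simp
qed

lemma up_corner:
  assumes "valid u" "u \<noteq> Root"
  shows "up u \<in> corners u"
  using assms by (cases "shared u"; cases u) (auto simp: corners_shared corners_nonshared)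

lemma down_corner:
  assumes u: "valid u" "u \<noteq> Root"
  shows "down u \<in> corners (lpar u)"
proof (cases u)
  case (Base i)
  then show ?thesis using u by (auto simp: corners_Root)
next
  case (C0 t)
  have "valid (prv t)" "prv t \<noteq> Root" "nxt (prv t) = t" using C0 u by auto
  then show ?thesis unfolding C0
    by (cases "shared (prv t)"; cases "prv t") (auto simp: corners_shared corners_nonshared)
next
  case (C1 t)
  then have "valid t" "t \<noteq> Root" using u by auto
  then show ?thesis unfolding C1
    by (cases "shared t"; cases t) (auto simp: corners_shared corners_nonshared)
next
  case (C2 t)
  then show ?thesis using u by (auto simp: corners_nonshared)
qed (use u in simp)

lemma corner_shape:
  assumes "valid u" "s \<in> corners u"
  obtains x where "valid x" "x \<noteq> Root" "s = up x \<or> s = down x"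
proof (cases "u = Root")
  case True
  then obtain i where "i < 7" "s = down (Base i)" using assms by (auto simp: corners_Root)
  then show ?thesis using that[of "Base i"] by simp
next
  case nonroot: False
  show ?thesis
  proof (cases "shared u")
    case True
    then obtain t where t: "u = C0 t" by (cases u) auto
    then have "valid t" "t \<noteq> Root" using assms by auto
    then show ?thesis using assms(2) t assms(1)
        that[of u] that[of "nxt u"] that[of "C1 u"] that[of "C0 (nxt u)"] that[of t]
      unfolding corners_shared[OF assms(1) t] by auto
  next
    case False
    then show ?thesis using assms(2) nonroot assms(1)
        that[of u] that[of "nxt u"] that[of "C1 u"] that[of "C2 u"] that[of "C0 (nxt u)"]
      unfolding corners_nonshared[OF assms(1) nonroot False] by auto
  qed
qed

definition adj :: "vert \<Rightarrow> vert \<Rightarrow> bool" where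
  "adj a b \<longleftrightarrow> valid a \<and> (b = a \<or> b \<in> set (nbrs a))"

lemma adj_vertical:
  assumes "valid x" "x \<noteq> Root"
  shows "adj x (prv x)" "adj (prv x) x" "adj x (C0 x)" "adj (C0 x) x"
    "adj (prv x) (C0 x)" "adj (C0 x) (prv x)"
    "adj x (lpar x)" "adj (lpar x) x" "adj (prv x) (lpar x)" "adj (lpar x) (prv x)"
proof -
  have nb: "nxt y \<in> set (nbrs y)" "prv y \<in> set (nbrs y)" "C0 y \<in> set (nbrs y)"
      "C0 (nxt y) \<in> set (nbrs y)" "C1 y \<in> set (nbrs y)" "lpar y \<in> set (nbrs y)"
      "last_child y \<in> set (nbrs y)"
    if "y \<noteq> Root" for y
    using that by (cases y; simp add: last_child_def)+
  show "adj x (prv x)" "adj (prv x) x" "adj x (C0 x)" "adj x (lpar x)" "adj (prv x) (C0 x)"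
    using nb[of x] nb[of "prv x"] assms by (auto simp: adj_def)
  show "adj (C0 x) x" "adj (C0 x) (prv x)" using assms by (auto simp: adj_def)
  show "adj (lpar x) x" "adj (prv x) (lpar x)" "adj (lpar x) (prv x)"
  proof (atomize (full), cases x)
    case (Base i)
    then show "adj (lpar x) x \<and> adj (prv x) (lpar x) \<and> adj (lpar x) (prv x)"
      using assms less_7_cases[of i] by (auto simp: adj_def)
  next
    case (C0 t)
    then have "nxt (prv t) = t" using assms by simp
    then show "adj (lpar x) x \<and> adj (prv x) (lpar x) \<and> adj (lpar x) (prv x)"
      using C0 assms nb[of "prv t"] nb[of "last_child (prv t)"] by (auto simp: adj_def)
  next
    case (C1 t)
    then show "adj (lpar x) x \<and> adj (prv x) (lpar x) \<and> adj (lpar x) (prv x)"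
      using assms nb[of t] by (auto simp: adj_def)
  next
    case (C2 t)
    then show "adj (lpar x) x \<and> adj (prv x) (lpar x) \<and> adj (lpar x) (prv x)"
      using assms nb[of t] nb[of "C1 t"] by (auto simp: adj_def last_child_def)
  qed (use assms in simp)
qed

text \<open>Since each corner is some \<open>up z\<close> or \<open>down z\<close>, whichever vertex
  it was listed at, only these two shapes need checking. Symmetry of \<open>adj\<close> and the
  triangle condition of the covering come from here.\<close>

lemma corner_clique:
  assumes "valid u" "s \<in> corners u" "x \<in> s" "y \<in> s"
  shows "adj x y"
proof -
  obtain z where z: "valid z" "z \<noteq> Root" "s = up z \<or> s = down z"
    using corner_shape assms(1,2) by blast
  have "adj z z" "adj (prv z) (prv z)" "adj (lpar z) (lpar z)" "adj (C0 z) (C0 z)"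
    using z by (simp_all add: adj_def)
  then show ?thesis
    using z(3) assms(3,4) adj_vertical[OF z(1,2)] unfolding up_def down_def by blast
qed

lemma nbr_in_corner:
  assumes "b \<in> set (nbrs a)"
  obtains s where "s \<in> corners a" "b \<in> s"
proof -
  obtain i where "i < 7" "b = nbrs a ! i" using assms by (metis in_set_conv_nth length_nbrs)
  then show ?thesis using that[of "{a, nbrs a ! i, nbrs a ! (Suc i mod 7)}"]
    by (auto simp: corners_def)
qed

lemma corner_members:
  assumes "s \<in> corners a"
  shows "a \<in> s" "s \<subseteq> insert a (set (nbrs a))"
  using assms by (auto simp: corners_def)

lemma adj_refl: "valid a \<Longrightarrow> adj a a"
  by (simp add: adj_def)

lemma adj_sym: "adj a b \<Longrightarrow> adj b a"
  by (metis adj_def corner_clique corner_members(1) nbr_in_corner)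

lemma adj_Root: "valid a \<Longrightarrow> (a, Root) \<in> {(x, y). adj x y}\<^sup>*"
proof (induction "level a" arbitrary: a)
  case (Suc n)
  then have a: "a \<noteq> Root" by auto
  then have "(lpar a, Root) \<in> {(x, y). adj x y}\<^sup>*"
    using Suc level_lpar[OF a] by auto
  moreover have "adj a (lpar a)" using adj_vertical Suc.prems a by blast
  ultimately show ?case by (simp add: converse_rtrancl_into_rtrancl)
qed simp


section \<open>Counting vertices and triangles of the model\<close>

definition sphere :: "nat \<Rightarrow> vert set" where
  "sphere n = {u. valid u \<and> level u = n}"

lemma sphere_1: "sphere (Suc 0) = Base ` {..<7}"
proof -
  have "u \<in> Base ` {..<7}" if "valid u" "level u = Suc 0" for u
    using that by (cases u) auto
  then show ?thesis by (auto simp: sphere_def)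
qed

lemma sphere_Suc:
  "sphere (Suc (Suc n)) =
     C0 ` sphere (Suc n) \<union> C1 ` sphere (Suc n) \<union> C2 ` {u \<in> sphere (Suc n). \<not> shared u}"
proof -
  have "u \<in> C0 ` sphere (Suc n) \<union> C1 ` sphere (Suc n) \<union> C2 ` {u \<in> sphere (Suc n). \<not> shared u}"
    if "valid u" "level u = Suc (Suc n)" for u
    using that by (cases u) (auto simp: sphere_def)
  then show ?thesis by (auto simp: sphere_def)
qed

lemma finite_sphere [simp]: "finite (sphere (Suc n))"
  by (induction n) (simp_all add: sphere_1 sphere_Suc)

text \<open>Unshared vertices are counted along: every vertex has a \<open>C0\<close> and a
  \<open>C1\<close> child, only unshared ones a \<open>C2\<close> child, so one level advances the
  Fibonacci index by two.\<close>

lemma card_sphere: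
  "card (sphere (Suc n)) = 7 * fib (2 * n + 2)"
  "card {u \<in> sphere (Suc n). \<not> shared u} = 7 * fib (2 * n + 1)"
proof (induction n)
  case 0
  have "{u \<in> sphere (Suc 0). \<not> shared u} = sphere (Suc 0)" by (auto simp: sphere_1)
  moreover have "card (sphere (Suc 0)) = 7" by (simp add: sphere_1 card_image inj_on_def)
  ultimately show "card (sphere (Suc 0)) = 7 * fib (2 * 0 + 2)"
    "card {u \<in> sphere (Suc 0). \<not> shared u} = 7 * fib (2 * 0 + 1)"
    by (simp_all add: numeral_2_eq_2)
next
  case (Suc n)
  let ?S = "sphere (Suc n)" and ?A = "{u \<in> sphere (Suc n). \<not> shared u}"
  have inj: "inj_on C0 X" "inj_on C1 X" "inj_on C2 X" for X by (auto simp: inj_on_def)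
  have "card (C1 ` ?S \<union> C2 ` ?A) = card ?S + card ?A"
    by (subst card_Un_disjoint) (auto simp: card_image inj)
  then have A: "card (C1 ` ?S \<union> C2 ` ?A) = 7 * fib (2 * Suc n + 1)" using Suc.IH by simp
  have "{u \<in> sphere (Suc (Suc n)). \<not> shared u} = C1 ` ?S \<union> C2 ` ?A"
    unfolding sphere_Suc by auto
  with A show "card {u \<in> sphere (Suc (Suc n)). \<not> shared u} = 7 * fib (2 * Suc n + 1)" by simp
  have "card (sphere (Suc (Suc n))) = card (C0 ` ?S) + card (C1 ` ?S \<union> C2 ` ?A)"
    unfolding sphere_Suc Un_assoc by (rule card_Un_disjoint) auto
  then show "card (sphere (Suc (Suc n))) = 7 * fib (2 * Suc n + 2)"
    unfolding A using Suc.IH by (simp add: card_image inj)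
qed

text \<open>\<open>Root\<close> is left out because the other vertices \<open>u\<close> correspond
  to the edges \<open>{u, prv u}\<close> that index the triangles.\<close>

definition punctured_ball :: "nat \<Rightarrow> vert set" where
  "punctured_ball n = {u. valid u \<and> u \<noteq> Root \<and> level u \<le> n}"

text \<open>Uses \<open>F 2 + F 4 + ... + F (2n) = F (2n+1) - 1\<close>; the summand 7 on the left
  avoids subtraction of naturals.\<close>

lemma card_punctured_ball:
  "finite (punctured_ball n) \<and> card (punctured_ball n) + 7 = 7 * fib (2 * n + 1)"
proof (induction n)
  case 0
  have "punctured_ball 0 = {}" by (auto simp: punctured_ball_def)
  then show ?case by simp
next
  case (Suc n)
  have eq: "punctured_ball (Suc n) = punctured_ball n \<union> sphere (Suc n)"
    by (auto simp: punctured_ball_def sphere_def le_Suc_eq)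
  have "card (punctured_ball (Suc n)) = card (punctured_ball n) + card (sphere (Suc n))"
    unfolding eq
  proof (rule card_Un_disjoint)
    show "punctured_ball n \<inter> sphere (Suc n) = {}" by (auto simp: punctured_ball_def sphere_def)
  qed (use Suc in simp_all)
  then show ?case using Suc unfolding card_sphere by (simp add: eq)
qed

text \<open>Rules out level cycles of length one or two, so that the set \<open>{u, prv u}\<close>
  determines \<open>u\<close>.\<close>

lemma prv_neq: "valid u \<Longrightarrow> u \<noteq> Root \<Longrightarrow> prv u \<noteq> u \<and> prv (prv u) \<noteq> u"
proof (induction u)
  case (Base i)
  then show ?case using less_7_cases[of i] by auto
next
  case (C0 u)
  then show ?case by (auto simp: last_child_def)
next
  case (C1 u)
  then show ?case by (auto simp: last_child_def)
qed auto

text \<open>An invariant that recovers the name of a triangle: above its lowest level,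
  \<open>up x\<close> has one vertex and \<open>down x\<close> has two.\<close>

definition upper :: "vert set \<Rightarrow> vert set" where
  "upper s = {z \<in> s. \<exists>w\<in>s. level w < level z}"

lemma upper_up: "upper (up x) = {C0 x}"
  by (auto simp: upper_def up_def)

lemma upper_down: "x \<noteq> Root \<Longrightarrow> upper (down x) = {x, prv x}"
  using level_lpar[of x] by (auto simp: upper_def down_def)

lemma inj_on_up: "inj_on up A"
proof (rule inj_onI)
  fix x y assume "up x = up y"
  then have "{C0 x} = {C0 y}" using upper_up by metis
  then show "x = y" by simp
qed

lemma inj_on_down: "inj_on down {u. valid u \<and> u \<noteq> Root}"
proof (rule inj_onI)
  fix x y assume "x \<in> {u. valid u \<and> u \<noteq> Root}" "y \<in> {u. valid u \<and> u \<noteq> Root}" "down x = down y"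
  then have xy: "valid x" "x \<noteq> Root" "y \<noteq> Root" "{x, prv x} = {y, prv y}"
    using upper_down[of x] upper_down[of y] by auto
  then show "x = y" using prv_neq[OF xy(1,2)] by (auto simp: doubleton_eq_iff)
qed

lemma up_neq_down:
  assumes "valid y" "y \<noteq> Root"
  shows "up x \<noteq> down y"
proof
  assume "up x = down y"
  then have "{C0 x} = {y, prv y}" using upper_up upper_down[OF assms(2)] by metis
  then show False using prv_neq[OF assms] by (metis insertCI singletonD)
qed

text \<open>The lowest vertices of \<open>up x\<close> are on the level of \<open>x\<close>, that of
  \<open>down x\<close> is one level below; hence the two different radii.\<close>

lemma corners_of_ball:
  "(\<Union>a\<in>{a. valid a \<and> level a \<le> r}. corners a) =
     up ` punctured_ball r \<union> down ` punctured_ball (Suc r)"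
proof (intro subset_antisym subsetI)
  fix s assume "s \<in> (\<Union>a\<in>{a. valid a \<and> level a \<le> r}. corners a)"
  then obtain a where a: "valid a" "level a \<le> r" "s \<in> corners a" by auto
  show "s \<in> up ` punctured_ball r \<union> down ` punctured_ball (Suc r)"
  proof (cases "a = Root")
    case True
    then show ?thesis using a by (auto simp: corners_Root punctured_ball_def)
  next
    case nonroot: False
    show ?thesis
    proof (cases "shared a")
      case True
      then obtain t where t: "a = C0 t" by (cases a) auto
      show ?thesis using a t unfolding corners_shared[OF a(1) t]
        by (auto simp: punctured_ball_def)
    next
      case False
      show ?thesis using a nonroot False unfolding corners_nonshared[OF a(1) nonroot False]
        by (auto simp: punctured_ball_def)
    qed
  qed
next
  fix s assume s: "s \<in> up ` punctured_ball r \<union> down ` punctured_ball (Suc r)"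
  from s show "s \<in> (\<Union>a\<in>{a. valid a \<and> level a \<le> r}. corners a)"
  proof
    assume "s \<in> up ` punctured_ball r"
    then show ?thesis using up_corner by (auto simp: punctured_ball_def)
  next
    assume "s \<in> down ` punctured_ball (Suc r)"
    then obtain u where u: "s = down u" "valid u" "u \<noteq> Root" "level u \<le> Suc r"
      by (auto simp: punctured_ball_def)
    then have "level (lpar u) \<le> r" using level_lpar[of u] by simp
    moreover have "valid (lpar u)" using u by simp
    ultimately show ?thesis using down_corner[OF u(2,3)] u(1) by blast
  qed
qed


section \<open>The developing map\<close>

text \<open>Breaks ties in the termination measure of \<open>develop\<close>, where
  \<open>C1\<close> and \<open>C2\<close> refer to earlier siblings on the same level.\<close>

fun child_index :: "vert \<Rightarrow> nat" where
  "child_index (C1 u) = 1"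
| "child_index (C2 u) = 2"
| "child_index u = 0"

lemma child_index_less: "child_index u < 3"
  by (cases u) auto

lemma level_lpar_le: "level (lpar u) \<le> level u"
  by (cases u) auto

text \<open>
  Unrolls \<open>K\<close> around \<open>v\<close> by reflecting across edges, starting from the cyclic list \<open>ys\<close> of the
  neighbours of \<open>v\<close>.
\<close>

function develop :: "'v set set \<Rightarrow> 'v \<Rightarrow> 'v list \<Rightarrow> vert \<Rightarrow> 'v" where
  "develop K v ys Root = v"
| "develop K v ys (Base i) = ys ! i"
| "develop K v ys (C0 u) =
     opp K (develop K v ys (lpar u)) {develop K v ys u, develop K v ys (prv u)}"
| "develop K v ys (C1 u) =
     opp K (develop K v ys (prv u)) {develop K v ys u, develop K v ys (C0 u)}"
| "develop K v ys (C2 u) =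
     opp K (develop K v ys (C0 u)) {develop K v ys u, develop K v ys (C1 u)}"
  by pat_completeness auto
termination
proof (relation "Wellfounded.measure (\<lambda>(K, v, ys, u). 3 * level u + child_index u)", goal_cases)
  case (2 K v ys u)
  then show ?case using child_index_less[of "lpar u"] level_lpar_le[of u] by simp
next
  case (3 K v ys u)
  then show ?case using child_index_less[of u] by simp
next
  case (4 K v ys u)
  then show ?case using child_index_less[of "prv u"] by simp
next
  case (5 K v ys u)
  then show ?case using child_index_less[of "prv u"] by simp
next
  case (6 K v ys u)
  then show ?case using child_index_less[of u] by simp
next
  case (8 K v ys u)
  then show ?case by simp
next
  case (9 K v ys u)
  then show ?case using child_index_less[of u] by simp
qed simp_all

declare develop.simps(3-5) [simp del]

section \<open>The developing map as a covering\<close>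

locale X7_development =
  fixes K :: "'v set set" and v :: 'v and ys :: "'v list"
  assumes X7: "is_X7 K" and hub: "v \<in> \<Union>K" and base: "wheel K v ys"
begin

abbreviation "f \<equiv> develop K v ys"

lemma surface: "triangulated_surface K"
  using X7 by (simp add: is_X7_def)

lemma complex: "abstract_complex K"
  using surface by (rule surface_complex)

lemma seven: "w \<in> \<Union>K \<Longrightarrow> card {t \<in> triangles K. w \<in> t} = 7"
  using X7 unfolding is_X7_def by blast

lemma map_base: "map f (nbrs Root) = ys"
proof (rule nth_equalityI)
  show "length (map f (nbrs Root)) = length ys" using base by (simp add: wheel_def)
  fix i assume "i < length (map f (nbrs Root))"
  then show "map f (nbrs Root) ! i = ys ! i" using less_7_cases[of i] by auto
qed

lemma wheel_corners:
  assumes "wheel K (f u) (map f (nbrs u))"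
  shows "{t \<in> triangles K. f u \<in> t} = (`) f ` corners u"
proof -
  have "{f u, map f (nbrs u) ! i, map f (nbrs u) ! (Suc i mod 7)} =
      f ` {u, nbrs u ! i, nbrs u ! (Suc i mod 7)}" if "i < 7" for i
    using that by simp
  then have "(\<lambda>i. {f u, map f (nbrs u) ! i, map f (nbrs u) ! (Suc i mod 7)}) ` {..<7} = (`) f ` corners u"
    unfolding corners_def image_image by (intro image_cong) auto
  then show ?thesis using assms unfolding wheel_def by simp
qed

text \<open>By induction on the level, the wheels at the parents supply the inner triangles at
  \<open>u\<close>. The remaining neighbours are images under \<open>opp\<close> by the equations of
  \<open>develop\<close>, so rotating around \<open>f u\<close> lists them in order and closes after
  seven steps.\<close>

lemma wheel_develop: "valid u \<Longrightarrow> wheel K (f u) (map f (nbrs u))"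
proof (induction "level u" arbitrary: u)
  case 0
  then show ?case using base map_base by simp
next
  case (Suc n)
  have u: "valid u" "u \<noteq> Root" using Suc by auto
  have IH: "wheel K (f t) (map f (nbrs t))" if "valid t" "Suc (level t) = level u" for t
    by (rule Suc.hyps(1)) (use Suc.hyps(2) that in simp_all)
  have corner: "f ` s \<in> triangles K" if "valid t" "Suc (level t) = level u" "s \<in> corners t" for s t
    using wheel_corners[OF IH[OF that(1,2)]] that(3) by blast
  have distinct: "distinct (map f (nbrs t))" if "valid t" "Suc (level t) = level u" for t
    using IH[OF that] by (simp add: wheel_def)
  \<comment> \<open>The inner triangle is a corner of the parent, which the induction hypothesis
    covers; it is needed for \<open>x = u\<close> and for the successor of \<open>u\<close>.\<close>
  have down: "{f x, f (lpar x), f (prv x)} \<in> triangles K" if x: "valid x" "level x = level u" for x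
  proof -
    have "x \<noteq> Root" using x u(2) by auto
    then have "f ` down x \<in> triangles K"
      by (intro corner[of "lpar x"] down_corner) (use x level_lpar in simp_all)
    moreover have "f ` down x = {f x, f (lpar x), f (prv x)}" by (auto simp: down_def)
    ultimately show ?thesis by simp
  qed
  have hub_u: "f u \<in> \<Union>K" using down[OF u(1)] by (auto simp: triangles_def)
  note wheelI = wheel_of_rotation[OF surface _ _ _ seven[OF hub_u]]
  have last: "f (C0 (nxt u)) = opp K (f (lpar (nxt u))) {f u, f (nxt u)}"
    using u by (simp add: develop.simps insert_commute)
  show ?case
  proof (cases "shared u")
    case True
    then obtain t where C0: "u = C0 t" by (cases u) auto
    have t: "valid t" "t \<noteq> Root" "Suc (level t) = level u" using u C0 by auto
    have p: "valid (prv t)" "prv t \<noteq> Root" "Suc (level (prv t)) = level u" "nxt (prv t) = t"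
      using t by auto
    have u_t: "{f u, f t, f (prv t)} \<in> triangles K"
    proof -
      have "f ` up t = {f u, f t, f (prv t)}" unfolding up_def C0 by auto
      then show ?thesis using corner[OF t(1,3) up_corner[OF t(1,2)]] by simp
    qed
    have nxt_t: "{f u, f (C1 t), f t} \<in> triangles K"
    proof -
      have "valid (C1 t)" "level (C1 t) = level u" using t by simp_all
      from down[OF this] show ?thesis unfolding C0 by (simp add: insert_commute)
    qed
    have prv_t: "{f u, f (prv t), f (prv u)} \<in> triangles K"
      using down[of u] u C0 by simp
    \<comment> \<open>Both non-turning conditions hold because the wheel at a parent,
      \<open>t\<close> or \<open>prv t\<close>, lists distinct vertices.\<close>
    have turn1: "f (C1 t) \<noteq> f (prv t)"
      using distinct[OF t(1,3)] t(2) by (cases t) (auto)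
    have turn2: "f (prv u) \<noteq> f t"
      using distinct[OF p(1,3)] p(2,4) C0
      by (cases "prv t") (auto simp: last_child_def)
    \<comment> \<open>\<open>prv u\<close> is not developed from \<open>u\<close>, but its triangle
      and that of \<open>t\<close> share the edge from \<open>u\<close> to \<open>prv t\<close>, so
      reflection gives it as well.\<close>
    have y3: "f (prv u) = opp K (f t) {f u, f (prv t)}"
      by (rule opp_eqI[OF surface, symmetric])
        (use u_t prv_t turn2 in \<open>simp_all add: insert_commute\<close>)
    have y4: "f (C0 u) = opp K (f (prv t)) {f u, f (prv u)}" using C0 by (simp add: develop.simps)
    have y6: "f (C0 (C1 t)) = opp K (f t) {f u, f (C1 t)}" using last C0 by simp
    have "wheel K (f u) [f (C1 t), f t, f (prv t), f (prv u), f (C0 u), f (C1 u), f (C0 (C1 t))]"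
      by (rule wheelI[OF nxt_t u_t turn1 y3 y4 develop.simps(4) y6])
    then show ?thesis unfolding C0 by simp
  next
    case ns: False
    \<comment> \<open>\<open>nxt u\<close> and \<open>prv u\<close> are distinct neighbours of the
      single parent of \<open>u\<close>, whose wheel separates their images.\<close>
    have turn: "f (nxt u) \<noteq> f (prv u)"
    proof (cases u)
      case (Base i)
      have "distinct ys" "length ys = 7" using base by (auto simp: wheel_def)
      then show ?thesis
        using Base u less_7_cases[of i] by (auto simp: nth_eq_iff_index_eq)
    next
      case (C1 t)
      then have t: "valid t" "t \<noteq> Root" "Suc (level t) = level u" using u by auto
      show ?thesis using distinct[OF t(1,3)] t(2) C1
        by (cases t) (auto)
    next
      case (C2 t)
      then have t: "valid t" "t \<noteq> Root" "Suc (level t) = level u" "\<not> shared t" using u by auto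
      show ?thesis using distinct[OF t(1,3)] t(2,4) C2
        by (cases t) (auto)
    qed (use u ns in auto)
    have nxt_par: "{f u, f (nxt u), f (lpar u)} \<in> triangles K"
      using down[of "nxt u"] u lpar_nxt[OF u(1) ns] by (simp add: insert_commute)
    have "f (C0 (nxt u)) = opp K (f (lpar u)) {f u, f (nxt u)}"
      using last lpar_nxt[OF u(1) ns] by simp
    then have "wheel K (f u)
        [f (nxt u), f (lpar u), f (prv u), f (C0 u), f (C1 u), f (C2 u), f (C0 (nxt u))]"
      by (rule wheelI[OF nxt_par down[OF u(1) refl] turn develop.simps(3-5)])
    then show ?thesis unfolding nbrs_nonshared[OF u(2) ns] by simp
  qed
qed

lemma inj_on_star:
  assumes "valid a"
  shows "inj_on f (insert a (set (nbrs a)))"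
proof -
  note w = wheel_develop[OF assms]
  have "inj_on f (set (nbrs a))" using w by (simp add: wheel_def distinct_map)
  moreover have "f a \<notin> set (map f (nbrs a))"
    using wheel_spoke(1)[OF complex w] by blast
  ultimately show ?thesis unfolding inj_on_insert by auto
qed

lemma vertex_develop:
  assumes "valid a"
  shows "f a \<in> \<Union>K"
proof -
  have "f (hd (nbrs a)) \<in> set (map f (nbrs a))" by (cases a) auto
  from wheel_spoke(2)[OF complex wheel_develop[OF assms] this] show ?thesis by blast
qed

text \<open>The wheel at \<open>f a\<close> shows that the triangle is the image of some corner, and
  injectivity on the star identifies that corner.\<close>

lemma corner_of_triangle:
  assumes "valid a" "{f a, f b, f c} \<in> triangles K" "b \<in> set (nbrs a)" "c \<in> set (nbrs a)"
  shows "{a, b, c} \<in> corners a"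
proof -
  have "{f a, f b, f c} \<in> (`) f ` corners a"
    using wheel_corners[OF wheel_develop[OF assms(1)]] assms(2) by blast
  then obtain s where s: "s \<in> corners a" "{f a, f b, f c} = f ` s" by (rule imageE)
  have "f ` {a, b, c} = f ` s \<longleftrightarrow> {a, b, c} = s"
    by (rule inj_on_image_eq_iff[OF inj_on_star[OF assms(1)] _ corner_members(2)[OF s(1)]])
      (use assms(3,4) in simp)
  moreover have "f ` {a, b, c} = f ` s" using s(2) by simp
  ultimately have "{a, b, c} = s" by (rule iffD1)
  then show ?thesis using s(1) by (rule ssubst)
qed

sublocale simplicial_covering K "{a. valid a}" f adj
proof
  show "abstract_complex K" by (rule complex)
  show "adj a a" if "a \<in> {a. valid a}" for a using that adj_refl by simp
  show "adj b a" if "adj a b" for a b using that by (rule adj_sym)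
  show "a \<in> {a. valid a}" if "adj a b" for a b using that by (simp add: adj_def)
  show "{f a, f b} \<in> K" if "adj a b" for a b
  proof (cases "b = a")
    case True
    then show ?thesis
      using vertex_develop[of a] that abstract_complex_face[OF complex, of _ "{f a}"]
      by (auto simp: adj_def)
  next
    case False
    then have "f b \<in> set (map f (nbrs a))" "valid a" using that by (auto simp: adj_def)
    then show ?thesis using wheel_spoke(2)[OF complex wheel_develop] by blast
  qed
  show "b = c" if "adj a b" "adj a c" "f b = f c" for a b c
    using inj_onD[OF inj_on_star[of a] that(3)] that(1,2) by (auto simp: adj_def)
  show "\<exists>b. adj a b \<and> f b = w" if "a \<in> {a. valid a}" "{f a, w} \<in> K" for a w
  proof (cases "w = f a")
    case False
    then have "w \<in> set (map f (nbrs a))"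
      using wheel_neighbour[OF surface wheel_develop that(2)] that(1) by blast
    then show ?thesis using that(1) by (auto simp: adj_def)
  qed (use that adj_refl in auto)
  show "adj b c" if abc: "adj a b" "adj a c" "{f a, f b, f c} \<in> K" for a b c
  proof (cases "a = b \<or> a = c \<or> b = c")
    case True
    then show ?thesis using abc(1,2) adj_sym adj_refl unfolding adj_def by metis
  next
    case False
    then have nb: "valid a" "b \<in> set (nbrs a)" "c \<in> set (nbrs a)" using abc by (auto simp: adj_def)
    \<comment> \<open>Injectivity on the star keeps the three vertices distinct, so their image is a
      triangle and lifts to a corner at \<open>a\<close>.\<close>
    have "card (f ` {a, b, c}) = card {a, b, c}"
      by (rule card_image, rule inj_on_subset[OF inj_on_star[OF nb(1)]]) (use nb in auto)
    then have "{f a, f b, f c} \<in> triangles K" using False abc(3) by (simp add: triangles_def)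
    from corner_clique[OF nb(1) corner_of_triangle[OF nb(1) this nb(2,3)]]
    show ?thesis by blast
  qed
qed

text \<open>The model is connected through \<open>Root\<close>, so any two vertices with the same
  image are joined by a chain, and the covering theorem applies.\<close>

lemma develop_inj: "inj_on f {a. valid a}"
proof (rule inj_onI)
  fix a b assume ab: "a \<in> {a. valid a}" "b \<in> {a. valid a}" "f a = f b"
  have "sym {(x, y). adj x y}" by (auto simp: sym_def intro: adj_sym)
  then have "(Root, b) \<in> {(x, y). adj x y}\<^sup>*"
    using adj_Root[of b] ab(2) sym_rtrancl symD by (metis mem_Collect_eq)
  with adj_Root[of a] ab(1) have "(a, b) \<in> {(x, y). adj x y}\<^sup>*" by simp
  then show "a = b"
    using simply_connected_covering_injective ab(3) X7 by (simp add: is_X7_def)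
qed

section \<open>Disks and their area\<close>

lemma triangles_touching_ball:
  "{t \<in> triangles K. t \<inter> f ` {a. valid a \<and> level a \<le> r} \<noteq> {}} =
     (`) f ` (up ` punctured_ball r \<union> down ` punctured_ball (Suc r))"
proof -
  have "{t \<in> triangles K. t \<inter> f ` {a. valid a \<and> level a \<le> r} \<noteq> {}} =
      (\<Union>a\<in>{a. valid a \<and> level a \<le> r}. {t \<in> triangles K. f a \<in> t})" by auto
  also have "\<dots> = (\<Union>a\<in>{a. valid a \<and> level a \<le> r}. (`) f ` corners a)"
    using wheel_corners[OF wheel_develop] by (intro SUP_cong) auto
  also have "\<dots> = (`) f ` (\<Union>a\<in>{a. valid a \<and> level a \<le> r}. corners a)" by (simp only: image_UN)
  finally show ?thesis unfolding corners_of_ball .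
qed

lemma disk_subset: "combinatorial_disk K v r \<subseteq> K"
proof (induction r)
  case 0
  then show ?case using hub abstract_complex_face[OF complex, of _ "{v}"] by auto
qed auto

text \<open>A triangle already in the disk meets it in its own vertices, and a newly added closed
  triangle has only itself as a face with three vertices.\<close>

lemma triangles_disk:
  "triangles (combinatorial_disk K v (Suc r)) =
     {t \<in> triangles K. t \<inter> \<Union>(combinatorial_disk K v r) \<noteq> {}}"
proof (intro subset_antisym subsetI)
  fix t assume t: "t \<in> triangles (combinatorial_disk K v (Suc r))"
  then have card: "card t = 3" and "t \<in> K" using disk_subset[of "Suc r"] by (auto simp: triangles_def)
  consider "t \<in> combinatorial_disk K v r"
    | t' where "t' \<in> triangles K" "t \<subseteq> t'" "t' \<inter> \<Union>(combinatorial_disk K v r) \<noteq> {}"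
    using t by (auto simp: triangles_def)
  then show "t \<in> {t \<in> triangles K. t \<inter> \<Union>(combinatorial_disk K v r) \<noteq> {}}"
  proof cases
    case 1
    moreover have "t \<noteq> {}" using card by auto
    ultimately show ?thesis using card \<open>t \<in> K\<close> by (auto simp: triangles_def)
  next
    case (2 t')
    have "card t' = 3" using 2(1) by (simp add: triangles_def)
    then have "t = t'" using 2(2) card by (metis card.infinite card_subset_eq zero_neq_numeral)
    then show ?thesis using 2 by simp
  qed
next
  fix t assume "t \<in> {t \<in> triangles K. t \<inter> \<Union>(combinatorial_disk K v r) \<noteq> {}}"
  then show "t \<in> triangles (combinatorial_disk K v (Suc r))" by (auto simp: triangles_def)
qed

text \<open>The triangles touching the ball of radius \<open>r\<close> reach no level beyond
  \<open>Suc r\<close>, and each vertex of level \<open>Suc r\<close> lies in its own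
  \<open>down\<close> triangle.\<close>

lemma disk_vertices: "\<Union>(combinatorial_disk K v r) = f ` {a. valid a \<and> level a \<le> r}"
proof (induction r)
  case 0
  have "{a. valid a \<and> level a \<le> 0} = {Root}" by auto
  then show ?case by simp
next
  case (Suc r)
  let ?T = "{t \<in> triangles K. t \<inter> \<Union>(combinatorial_disk K v r) \<noteq> {}}"
  have "\<Union>(combinatorial_disk K v (Suc r)) = \<Union>(combinatorial_disk K v r) \<union> \<Union>?T"
    by (auto simp: triangles_def)
  also have "\<Union>?T = f ` \<Union>(up ` punctured_ball r \<union> down ` punctured_ball (Suc r))"
    unfolding Suc.IH triangles_touching_ball by (rule image_Union[symmetric])
  finally have eq: "\<Union>(combinatorial_disk K v (Suc r)) =
      f ` ({a. valid a \<and> level a \<le> r} \<union> \<Union>(up ` punctured_ball r \<union> down ` punctured_ball (Suc r)))"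
    unfolding Suc.IH image_Un .
  have "{a. valid a \<and> level a \<le> r} \<union> \<Union>(up ` punctured_ball r \<union> down ` punctured_ball (Suc r)) =
      {a. valid a \<and> level a \<le> Suc r}" (is "?L = ?R")
  proof (intro subset_antisym subsetI)
    fix a assume "a \<in> ?L"
    then show "a \<in> ?R"
      using order_trans[OF level_lpar_le] by (auto simp: up_def down_def punctured_ball_def)
  next
    fix a assume "a \<in> ?R"
    then show "a \<in> ?L"
      by (cases "a = Root") (auto simp: down_def punctured_ball_def)
  qed
  then show ?case unfolding eq by simp
qed

lemma area:
  "combinatorial_area K v (Suc r) = card (punctured_ball r) + card (punctured_ball (Suc r))"
proof -
  let ?U = "up ` punctured_ball r" and ?D = "down ` punctured_ball (Suc r)"
  have fin: "finite (punctured_ball n)" for n using card_punctured_ball by blast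
  \<comment> \<open>Global injectivity enters here: different triangles of the model have different
    images.\<close>
  have "inj_on ((`) f) (Pow {a. valid a})"
    using develop_inj by (rule inj_on_image_Pow)
  moreover have "?U \<union> ?D \<subseteq> Pow {a. valid a}"
    by (auto simp: up_def down_def punctured_ball_def)
  ultimately have "card ((`) f ` (?U \<union> ?D)) = card (?U \<union> ?D)"
    by (meson card_image inj_on_subset)
  also have "\<dots> = card ?U + card ?D"
  proof (rule card_Un_disjoint)
    show "?U \<inter> ?D = {}" using up_neq_down by (auto simp: punctured_ball_def)
  qed (use fin in simp_all)
  also have "card ?U = card (punctured_ball r)" by (rule card_image) (rule inj_on_up)
  also have "card ?D = card (punctured_ball (Suc r))"
    by (rule card_image, rule inj_on_subset[OF inj_on_down]) (auto simp: punctured_ball_def)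
  finally show ?thesis
    unfolding combinatorial_area_def triangles_disk disk_vertices triangles_touching_ball .
qed

end

section \<open>The Fibonacci formula\<close>

lemma area_fib:
  assumes "is_X7 K" "v \<in> \<Union>K"
  shows "combinatorial_area K v (Suc r) + 14 = 7 * fib (2 * r + 1) + 7 * fib (2 * r + 3)"
proof -
  obtain ys where "wheel K v ys"
    using wheel_exists[of K v] assms by (auto simp: is_X7_def)
  then interpret X7_development K v ys using assms by unfold_locales
  \<comment> \<open>Each of the two balls falls short of its Fibonacci term by 7, whence 14.\<close>
  show ?thesis using area[of r] card_punctured_ball[of r] card_punctured_ball[of "Suc r"]
    by (simp add: eval_nat_numeral)
qed

theorem theorem2:
  fixes K :: "'v set set" and v :: 'v and r :: nat
  assumes "is_X7 K" and "v \<in> \<Union>K" and "r \<ge> 1"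
  shows "int (combinatorial_area K v r) =
    7 * (4 * fib_int (2 * int r - 2) + 3 * fib_int (2 * int r - 3) - 2)"
proof -
  obtain n where r: "r = Suc n" using assms(3) by (cases r) auto
  have "fib_int (int m) = int (fib m)" for m by (simp add: fib_int_def)
  from this[of "2 * n"] this[of "2 * n + 1"]
  have f0: "fib_int (2 * int n) = int (fib (2 * n))"
    and f1: "fib_int (2 * int n + 1) = int (fib (2 * n + 1))" by (simp_all add: add.commute)
  \<comment> \<open>Taken from the integer recurrence so that \<open>n = 0\<close>, with index -1,
    is included.\<close>
  have "fib_int (2 * int n - 1) = int (fib (2 * n + 1)) - int (fib (2 * n))"
    using fib_int_rec[of "2 * int n"] f0 f1 by simp
  moreover have "2 * int r - 2 = 2 * int n" "2 * int r - 3 = 2 * int n - 1" using r by auto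
  moreover have "int (combinatorial_area K v r) + 14 =
      7 * int (fib (2 * n + 1)) + 7 * int (fib (2 * n + 3))"
    using arg_cong[OF area_fib[OF assms(1,2), of n], of int] r by simp
  \<comment> \<open>With \<open>F (2n+1) = F (2n) + F (2n-1)\<close>, the sum
    \<open>F (2n+1) + F (2n+3)\<close> becomes \<open>4 F (2n) + 3 F (2n-1)\<close>.\<close>
  moreover have "fib (2 * n + 3) = 2 * fib (2 * n + 1) + fib (2 * n)"
    by (simp add: eval_nat_numeral)
  ultimately show ?thesis using f0 by simp
qed

end
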